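(* Let $q\ge 2$ be an integer. For any measurable function $f:\mathbb{T}\to[0,1]$, the branching-Toeplitz kernel $\Gamma_q[f]$ represents a positive definite contractive operator on $\ell^2(T_q)$ and thus induces a determinantal point process on $T_q$, and this process is a branching-type SSSP and is invariant under the natural action of the group of automorphisms of $T_q$.
   Context: $T_q$ denotes the (vertex set of the) infinite rooted $q$-homogeneous tree: there is a root $o$, and each vertex has exactly $q$ children. $d$ is the graph distance and $|\sigma| := d(o,\sigma)$. A rooted geodesic ray is a geodesic ray starting at the root; as a subset of $T_q$ it is canonically identified with $\mathbb{N}=\{0,1,2,\dots\}$ via $\sigma\mapsto|\sigma|$. Two vertices are comparable if they lie on a common rooted geodesic ray; $\mathcal{C}\subset T_q\times T_q$ is the set of comparable pairs, with indicator $\mathbf{1}_{\mathcal{C}}$. $\mathbb{T}=\mathbb{R}/2\pi\mathbb{Z}$, $\widehat f(n)=\int_{\mathbb{T}} f(e^{i\theta})e^{-in\theta}\frac{d\theta}{2\pi}$, and $\Gamma_q[f](\sigma_1,\sigma_2) := q^{-d(\sigma_1,\sigma_2)/2}\,\widehat f(|\sigma_1|-|\sigma_2|)\,\mathbf{1}_{\mathcal{C}}(\sigma_1,\sigma_2)$. A bounded operator $A$ on $\ell^2(T_q)$ is identified with its kernel $A(\sigma_1,\sigma_2)=\langle A\delta_{\sigma_2},\delta_{\sigma_1}\rangle$. Positive definite means non-negative definite. The determinantal point process on $T_q$ induced by a kernel $K$ (considered as a stochastic process $(X_\sigma)_{\sigma\in T_q}$ of $\{0,1\}$-valued random variables) is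 the process whose law is determined by $\mathbb{P}(X_{\sigma_1}=\cdots=X_{\sigma_m}=1)=\det[K(\sigma_i,\sigma_j)]_{1\le i,j\le m}$ for all $m\ge 1$ and distinct $\sigma_1,\dots,\sigma_m\in T_q$. A stochastic process $(X_\sigma)_{\sigma\in T_q}$ is a branching-type SSSP (strong stationary stochastic process) if: (i) for every rooted geodesic ray $\xi\simeq\mathbb{N}$, $X^\xi=(X_\sigma)_{\sigma\in\xi}$ is a strong (i.e. strictly) stationary process indexed by $\mathbb{N}$; (ii) for any two rooted geodesic rays $\xi,\xi'$, using $\xi\simeq\mathbb{N}\simeq\xi'$, the processes $X^\xi$ and $X^{\xi'}$ have the same distribution; (iii) for any pair of non-comparable vertices $\sigma,\tau$, the random variables $X_\sigma,X_\tau$ are independent. Invariance under automorphisms means that $(X_{\gamma(\sigma)})_{\sigma\in T_q}$ has the same law as $(X_\sigma)_{\sigma\in T_q}$ for each (rooted) tree automorphism $\gamma$ of $T_q$. *)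

theory Defs
  imports "HOL-Probability.Probability" "Jordan_Normal_Form.Determinant"
begin

section \<open>The rooted homogeneous tree\<close>

text \<open>A vertex of the tree is the word of child indices leading to it from the root \<open>[]\<close>.\<close>

definition tree_vertices :: "nat \<Rightarrow> nat list set" where
  "tree_vertices q = {\<sigma>. set \<sigma> \<subseteq> {..<q}}"

definition tree_adj :: "nat \<Rightarrow> nat list \<Rightarrow> nat list \<Rightarrow> bool" where
  "tree_adj q \<sigma> \<tau> \<longleftrightarrow> \<sigma> \<in> tree_vertices q \<and> \<tau> \<in> tree_vertices q \<and>
     ((\<exists>i. \<tau> = \<sigma> @ [i]) \<or> (\<exists>i. \<sigma> = \<tau> @ [i]))"

definition tree_dist :: "nat \<Rightarrow> nat list \<Rightarrow> nat list \<Rightarrow> nat" where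
  "tree_dist q \<sigma> \<tau> = (LEAST n. (tree_adj q ^^ n) \<sigma> \<tau>)"

definition tree_level :: "nat \<Rightarrow> nat list \<Rightarrow> nat" where
  "tree_level q \<sigma> = tree_dist q [] \<sigma>"

text \<open>A rooted ray is given by its parametrization by distance to the root, which is its
  identification with the natural numbers.\<close>

definition rooted_geodesic_ray :: "nat \<Rightarrow> (nat \<Rightarrow> nat list) \<Rightarrow> bool" where
  "rooted_geodesic_ray q \<xi> \<longleftrightarrow> \<xi> 0 = [] \<and> range \<xi> \<subseteq> tree_vertices q \<and>
     (\<forall>m n. int (tree_dist q (\<xi> m) (\<xi> n)) = \<bar>int m - int n\<bar>)"

definition comparable :: "nat \<Rightarrow> nat list \<Rightarrow> nat list \<Rightarrow> bool" where
  "comparable q \<sigma> \<tau> \<longleftrightarrow> (\<exists>\<xi>. rooted_geodesic_ray q \<xi> \<and> \<sigma> \<in> range \<xi> \<and> \<tau> \<in> range \<xi>)"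

definition tree_automorphism :: "nat \<Rightarrow> (nat list \<Rightarrow> nat list) \<Rightarrow> bool" where
  "tree_automorphism q \<gamma> \<longleftrightarrow>
     bij_betw \<gamma> (tree_vertices q) (tree_vertices q) \<and> \<gamma> [] = [] \<and>
     (\<forall>\<sigma>\<in>tree_vertices q. \<forall>\<tau>\<in>tree_vertices q. tree_adj q (\<gamma> \<sigma>) (\<gamma> \<tau>) \<longleftrightarrow> tree_adj q \<sigma> \<tau>)"

section \<open>Branching-Toeplitz kernels\<close>

text \<open>Functions on the circle are functions on \<open>complex\<close> of which only the values on the unit
  circle matter.\<close>

definition fourier_coeff :: "(complex \<Rightarrow> real) \<Rightarrow> int \<Rightarrow> complex" where
  "fourier_coeff f n =
     (LINT \<theta>:{0..2*pi}|lebesgue. complex_of_real (f (cis \<theta>)) * cis (- (of_int n * \<theta>)))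
       / complex_of_real (2*pi)"

definition branching_toeplitz ::
    "nat \<Rightarrow> (complex \<Rightarrow> real) \<Rightarrow> nat list \<Rightarrow> nat list \<Rightarrow> complex" where
  "branching_toeplitz q f \<sigma> \<tau> =
     complex_of_real (real q powr (- real (tree_dist q \<sigma> \<tau>) / 2))
       * fourier_coeff f (int (tree_level q \<sigma>) - int (tree_level q \<tau>))
       * of_bool (comparable q \<sigma> \<tau>)"

section \<open>Operators on the Hilbert space of square-summable functions\<close>

text \<open>Functions on \<open>I\<close> are extended by zero, so that equality in \<open>ell2 I\<close> is equality of
  HOL functions. The behaviour of operators outside \<open>ell2 I\<close> is irrelevant.\<close>

definition ell2 :: "'a set \<Rightarrow> ('a \<Rightarrow> complex) set" where
  "ell2 I = {u. (\<forall>i. i \<notin> I \<longrightarrow> u i = 0) \<and> (\<lambda>i. (norm (u i))\<^sup>2) summable_on I}"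

definition ell2_inner :: "'a set \<Rightarrow> ('a \<Rightarrow> complex) \<Rightarrow> ('a \<Rightarrow> complex) \<Rightarrow> complex" where
  "ell2_inner I u v = infsum (\<lambda>i. u i * cnj (v i)) I"

definition ell2_norm :: "'a set \<Rightarrow> ('a \<Rightarrow> complex) \<Rightarrow> real" where
  "ell2_norm I u = sqrt (infsum (\<lambda>i. (norm (u i))\<^sup>2) I)"

definition ell2_delta :: "'a \<Rightarrow> 'a \<Rightarrow> complex" where
  "ell2_delta i j = of_bool (j = i)"

definition bounded_operator :: "'a set \<Rightarrow> (('a \<Rightarrow> complex) \<Rightarrow> ('a \<Rightarrow> complex)) \<Rightarrow> bool" where
  "bounded_operator I A \<longleftrightarrow>
     (\<forall>u\<in>ell2 I. A u \<in> ell2 I) \<and>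
     (\<forall>u\<in>ell2 I. \<forall>v\<in>ell2 I. A (\<lambda>i. u i + v i) = (\<lambda>i. A u i + A v i)) \<and>
     (\<forall>c. \<forall>u\<in>ell2 I. A (\<lambda>i. c * u i) = (\<lambda>i. c * A u i)) \<and>
     (\<exists>C. \<forall>u\<in>ell2 I. ell2_norm I (A u) \<le> C * ell2_norm I u)"

definition operator_kernel ::
    "'a set \<Rightarrow> (('a \<Rightarrow> complex) \<Rightarrow> ('a \<Rightarrow> complex)) \<Rightarrow> 'a \<Rightarrow> 'a \<Rightarrow> complex" where
  "operator_kernel I A i j = ell2_inner I (A (ell2_delta j)) (ell2_delta i)"

definition positive_definite :: "'a set \<Rightarrow> (('a \<Rightarrow> complex) \<Rightarrow> ('a \<Rightarrow> complex)) \<Rightarrow> bool" where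
  "positive_definite I A \<longleftrightarrow>
     (\<forall>u\<in>ell2 I. ell2_inner I (A u) u \<in> \<real> \<and> 0 \<le> Re (ell2_inner I (A u) u))"

definition contractive :: "'a set \<Rightarrow> (('a \<Rightarrow> complex) \<Rightarrow> ('a \<Rightarrow> complex)) \<Rightarrow> bool" where
  "contractive I A \<longleftrightarrow> (\<forall>u\<in>ell2 I. ell2_norm I (A u) \<le> ell2_norm I u)"

section \<open>Processes with values in \<open>{0, 1}\<close>\<close>

abbreviation bit_space :: "nat measure" where
  "bit_space \<equiv> count_space {0, 1}"

definition bit_process :: "'w measure \<Rightarrow> 'i set \<Rightarrow> ('i \<Rightarrow> 'w \<Rightarrow> nat) \<Rightarrow> bool" where
  "bit_process M I X \<longleftrightarrow> prob_space M \<and> (\<forall>i\<in>I. X i \<in> measurable M bit_space)"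

definition process_law ::
    "'w measure \<Rightarrow> 'i set \<Rightarrow> ('i \<Rightarrow> 'w \<Rightarrow> nat) \<Rightarrow> ('i \<Rightarrow> nat) measure" where
  "process_law M I X = distr M (PiM I (\<lambda>_. bit_space)) (\<lambda>\<omega>. \<lambda>i\<in>I. X i \<omega>)"

text \<open>A finite family of distinct points is a \<open>distinct\<close> list. The qualified names select the
  determinant for matrices of variable size, as opposed to the one in \<open>HOL-Analysis\<close>.\<close>

definition determinantal_process ::
    "'w measure \<Rightarrow> 'i set \<Rightarrow> ('i \<Rightarrow> 'i \<Rightarrow> complex) \<Rightarrow> ('i \<Rightarrow> 'w \<Rightarrow> nat) \<Rightarrow> bool" where
  "determinantal_process M I K X \<longleftrightarrow> bit_process M I X \<and>
     (\<forall>s. s \<noteq> [] \<and> distinct s \<and> set s \<subseteq> I \<longrightarrow>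
        complex_of_real (measure M {\<omega> \<in> space M. \<forall>i\<in>set s. X i \<omega> = 1}) =
        Determinant.det (Matrix.mat (length s) (length s) (\<lambda>(i, j). K (s ! i) (s ! j))))"

definition strictly_stationary :: "'w measure \<Rightarrow> (nat \<Rightarrow> 'w \<Rightarrow> nat) \<Rightarrow> bool" where
  "strictly_stationary M Y \<longleftrightarrow>
     (\<forall>k. process_law M UNIV (\<lambda>n. Y (n + k)) = process_law M UNIV Y)"

definition branching_SSSP :: "nat \<Rightarrow> 'w measure \<Rightarrow> (nat list \<Rightarrow> 'w \<Rightarrow> nat) \<Rightarrow> bool" where
  "branching_SSSP q M X \<longleftrightarrow> bit_process M (tree_vertices q) X \<and>
     (\<forall>\<xi>. rooted_geodesic_ray q \<xi> \<longrightarrow> strictly_stationary M (\<lambda>n. X (\<xi> n))) \<and>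
     (\<forall>\<xi> \<xi>'. rooted_geodesic_ray q \<xi> \<and> rooted_geodesic_ray q \<xi>' \<longrightarrow>
        process_law M UNIV (\<lambda>n. X (\<xi> n)) = process_law M UNIV (\<lambda>n. X (\<xi>' n))) \<and>
     (\<forall>\<sigma>\<in>tree_vertices q. \<forall>\<tau>\<in>tree_vertices q. \<not> comparable q \<sigma> \<tau> \<longrightarrow>
        prob_space.indep_var M bit_space (X \<sigma>) bit_space (X \<tau>))"

definition automorphism_invariant ::
    "nat \<Rightarrow> 'w measure \<Rightarrow> (nat list \<Rightarrow> 'w \<Rightarrow> nat) \<Rightarrow> bool" where
  "automorphism_invariant q M X \<longleftrightarrow>
     (\<forall>\<gamma>. tree_automorphism q \<gamma> \<longrightarrow>
        process_law M (tree_vertices q) (\<lambda>\<sigma>. X (\<gamma> \<sigma>)) = process_law M (tree_vertices q) X)"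

end

theory Submission
  imports Defs "HOL-Library.Sublist"
begin

text \<open>
  Three observations carry the proof.

  \<^item> \<open>\<Gamma>\<^sub>q[f]\<close> is an average of Toeplitz forms. Attach to a vertex \<open>\<sigma>\<close> the function
  \<open>q powr (|\<sigma>|/2) \<cdot> [\<sigma> is a prefix of w] \<cdot> cis (|\<sigma>| \<theta>)\<close> of a uniformly chosen word \<open>w\<close> of large
  length \<open>N\<close> and a uniformly chosen angle \<open>\<theta>\<close>. Two comparable vertices have \<open>q ^ (N - m)\<close> common
  descendants on the sphere of radius \<open>N\<close>, where \<open>m\<close> is the larger of their levels, and non-comparable
  ones have none; hence the inner product
  with weight \<open>f(cis \<theta>)\<close> of the functions attached to two vertices is exactly the entry of the
  kernel, and \<open>f \<ge> 0\<close> makes the kernel positive definite (\<open>psd_branching_toeplitz\<close>). Moreover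
  \<open>\<Gamma>\<^sub>q[1]\<close> is the identity, since at equal levels only equal vertices are comparable. Therefore
  \<open>1 - \<Gamma>\<^sub>q[f] = \<Gamma>\<^sub>q[1 - f]\<close> is positive definite as well, which is contractivity. Finite sections
  determine a bounded operator because the bounds do not depend on the section
  (\<open>contraction_kernel_operator\<close>).

  \<^item> Any kernel \<open>K\<close> with \<open>0 \<le> K \<le> 1\<close> is the kernel of a determinantal process
  (\<open>determinantal_law_exists\<close>). On finitely many sites the process is sampled one site at a time:
  site \<open>i\<close> is occupied with probability \<open>K i i\<close>, and given this bit the remaining sites form a
  determinantal process whose kernel is the Schur complement of \<open>K\<close> at \<open>i\<close> if the site is
  occupied, and \<open>1\<close> minus the Schur complement of \<open>1 - K\<close> at \<open>i\<close> if it is empty. Both kernels lie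
  again between \<open>0\<close> and \<open>1\<close>, so every step has a genuine probability, and expanding determinants
  along \<open>i\<close> shows that the inclusion probabilities of the mixture are the minors of \<open>K\<close>.
  Kolmogorov's theorem passes to infinitely many sites.

  \<^item> The law of a process of bits is determined by the probabilities that given finitely many bits
  are all \<open>1\<close>, as these events form a generating \<open>\<pi>\<close>-system. So a determinantal process has a law
  that depends on the kernel alone, and stationarity along rays, equality of the laws along any
  two rays and invariance under automorphisms are identities between kernels
  (\<open>determinantal_process_reindex\<close>): along a ray the kernel is the Toeplitz kernel
  \<open>q powr (- |m - n|/2) \<cdot> f^(m - n)\<close>, and automorphisms preserve distance, level and comparability.
  At a non-comparable pair the kernel vanishes, so the \<open>2 \<times> 2\<close> minor is a product, and two bits
  whose joint success probability factors are independent.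
\<close>

section \<open>Determinants of finite sections of a kernel\<close>

definition kernel_mat :: "('a \<Rightarrow> 'a \<Rightarrow> complex) \<Rightarrow> 'a list \<Rightarrow> complex Matrix.mat" where
  "kernel_mat K s = Matrix.mat (length s) (length s) (\<lambda>(a, b). K (s ! a) (s ! b))"

text \<open>If \<open>K\<close> is the kernel of a determinantal process, this is the kernel of the process on the
  other sites conditioned on site \<open>i\<close> being occupied. If \<open>K i i = 0\<close> then division by zero leaves
  \<open>K\<close> unchanged, which is harmless because that event is null.\<close>

definition schur_complement :: "('a \<Rightarrow> 'a \<Rightarrow> complex) \<Rightarrow> 'a \<Rightarrow> 'a \<Rightarrow> 'a \<Rightarrow> complex" where
  "schur_complement K i = (\<lambda>x y. K x y - K x i * K i y / K i i)"

text \<open>The kernel of the process of unoccupied sites. Exchanging occupied and empty sites turns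
  conditioning on an empty site into conditioning on an occupied one, so only one kind of
  conditioning has to be analysed.\<close>

definition hole_kernel :: "('a \<Rightarrow> 'a \<Rightarrow> complex) \<Rightarrow> 'a \<Rightarrow> 'a \<Rightarrow> complex" where
  "hole_kernel K = (\<lambda>x y. of_bool (x = y) - K x y)"

lemma kernel_mat_carrier [simp]: "kernel_mat K s \<in> carrier_mat (length s) (length s)"
  by (simp add: kernel_mat_def)

lemma kernel_mat_cong:
  assumes "\<And>x y. x \<in> set s \<Longrightarrow> y \<in> set s \<Longrightarrow> K x y = K' x y"
  shows "kernel_mat K s = kernel_mat K' s"
  unfolding kernel_mat_def using assms by (intro cong_mat) auto

text \<open>Minors are attached to sets of sites rather than to enumerations of them: reordering permutes
  rows and columns simultaneously, and the two signs cancel.\<close>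

lemma det_kernel_mat_perm:
  assumes "distinct s" "distinct t" "set s = set t"
  shows "Determinant.det (kernel_mat K s) = Determinant.det (kernel_mat K t)"
proof -
  have "mset s = mset t" using assms by (simp add: set_eq_iff_mset_eq_distinct)
  then obtain p where p: "p permutes {..<length t}" "permute_list p t = s"
    by (rule mset_eq_permutation)
  let ?n = "length t"
  have len: "length s = ?n" using p(2) by auto
  have p': "p permutes {0..<?n}" using p(1) by (simp add: lessThan_atLeast0)
  have lt: "p i < ?n" if "i < ?n" for i using permutes_in_image[OF p(1), of i] that by auto
  have nth: "s ! i = t ! p i" if "i < ?n" for i
    using p that by (metis permute_list_nth)
  define B where "B = Matrix.mat ?n ?n (\<lambda>(i, j). kernel_mat K t $$ (p i, j))"
  have B: "B \<in> carrier_mat ?n ?n" by (simp add: B_def)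
  have eq: "kernel_mat K s = transpose_mat (Matrix.mat ?n ?n (\<lambda>(i, j). transpose_mat B $$ (p i, j)))"
    by (rule eq_matI) (auto simp: kernel_mat_def len nth lt B_def)
  have "Determinant.det (kernel_mat K s) = signof p * Determinant.det (transpose_mat B)"
    unfolding eq
    by (subst det_transpose[of _ ?n], simp, rule det_permute_rows) (use B p' in auto)
  also have "Determinant.det (transpose_mat B) = signof p * Determinant.det (kernel_mat K t)"
    unfolding det_transpose[OF B] unfolding B_def
    by (rule det_permute_rows[OF kernel_mat_carrier p'])
  finally show ?thesis by (simp add: sign_def)
qed

lemma det_kernel_mat_zero_row:
  assumes "\<And>y. y \<in> set (i # s) \<Longrightarrow> K i y = 0"
  shows "Determinant.det (kernel_mat K (i # s)) = 0"
proof -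
  have "Determinant.det (kernel_mat K (i # s)) =
    (\<Sum>j<length (i # s). kernel_mat K (i # s) $$ (0, j) * cofactor (kernel_mat K (i # s)) 0 j)"
    by (rule laplace_expansion_row[OF kernel_mat_carrier]) simp
  also have "\<dots> = 0"
    by (rule sum.neutral) (use assms nth_mem[of _ "i # s"] in \<open>auto simp: kernel_mat_def simp del: set_simps nth_Cons\<close>)
  finally show ?thesis .
qed

text \<open>One step of Gaussian elimination with pivot \<open>K i i\<close>. The assumption is what survives of
  positivity when the pivot vanishes: then the whole row is zero and so are both sides.\<close>

lemma det_kernel_mat_Cons:
  assumes "K i i = 0 \<Longrightarrow> (\<forall>y\<in>set s. K i y = 0)"
  shows "Determinant.det (kernel_mat K (i # s)) = K i i * Determinant.det (kernel_mat (schur_complement K i) s)"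
proof (cases "K i i = 0")
  case True
  then show ?thesis using assms det_kernel_mat_zero_row[of i s K] by auto
next
  case False
  let ?n = "length s"
  \<comment> \<open>Factor the section into a unit lower triangular matrix and the eliminated one.\<close>
  define L where "L = four_block_mat (1\<^sub>m 1) (0\<^sub>m 1 ?n) (Matrix.mat ?n 1 (\<lambda>(a, _). K (s ! a) i / K i i)) (1\<^sub>m ?n)"
  define U where "U = four_block_mat (Matrix.mat 1 1 (\<lambda>_. K i i)) (Matrix.mat 1 ?n (\<lambda>(_, b). K i (s ! b)))
    (0\<^sub>m ?n 1) (kernel_mat (schur_complement K i) s)"
  have "kernel_mat K (i # s) = L * U"
    unfolding L_def U_def
    apply (subst mult_four_block_mat[of _ 1 1 _ ?n _ ?n])
           apply (auto simp: kernel_mat_def)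
    apply (rule eq_matI)
    using False by (auto simp: schur_complement_def scalar_prod_def nth_Cons' split: if_splits)
  moreover have "L \<in> carrier_mat (1 + ?n) (1 + ?n)" "U \<in> carrier_mat (1 + ?n) (1 + ?n)"
    using four_block_carrier_mat[of "1\<^sub>m 1" 1 1 "1\<^sub>m ?n" ?n ?n]
      four_block_carrier_mat[of "Matrix.mat 1 1 (\<lambda>_. K i i)" 1 1 "kernel_mat (schur_complement K i) s" ?n ?n]
    unfolding L_def U_def by auto
  ultimately have "Determinant.det (kernel_mat K (i # s)) = Determinant.det L * Determinant.det U"
    by (simp add: det_mult)
  moreover have "Determinant.det L = 1"
    unfolding L_def by (subst det_four_block_mat_upper_right_zero[of _ 1 _ ?n]) auto
  moreover have "Determinant.det U = K i i * Determinant.det (kernel_mat (schur_complement K i) s)"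
    unfolding U_def by (subst det_four_block_mat_lower_left_zero[of _ 1 _ ?n]) (auto simp: det_single)
  ultimately show ?thesis by simp
qed

text \<open>Linearity of the determinant in its first row, read off from Laplace expansion: the cofactors
  of that row do not see it.\<close>

lemma det_kernel_mat_row_diff:
  assumes "i \<notin> set s"
  assumes "\<And>y. y \<in> set (i # s) \<Longrightarrow> K i y = K1 i y - K2 i y"
  assumes "\<And>x y. x \<in> set s \<Longrightarrow> y \<in> set (i # s) \<Longrightarrow> K x y = K1 x y \<and> K1 x y = K2 x y"
  shows "Determinant.det (kernel_mat K (i # s)) = Determinant.det (kernel_mat K1 (i # s)) - Determinant.det (kernel_mat K2 (i # s))"
proof -
  let ?t = "i # s"
  let ?n = "length ?t"
  have exp: "Determinant.det (kernel_mat M ?t) = (\<Sum>j<?n. kernel_mat M ?t $$ (0, j) * cofactor (kernel_mat M ?t) 0 j)" for M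
    by (rule laplace_expansion_row[OF kernel_mat_carrier]) simp
  have del: "mat_delete (kernel_mat M ?t) 0 j = mat_delete (kernel_mat N ?t) 0 j"
    if "\<And>x y. x \<in> set s \<Longrightarrow> y \<in> set ?t \<Longrightarrow> M x y = N x y" for M N j
    unfolding mat_delete_def kernel_mat_def
    by (rule cong_mat) (auto intro!: that simp: nth_Cons split: nat.splits)
  have c: "cofactor (kernel_mat K ?t) 0 j = cofactor (kernel_mat K1 ?t) 0 j"
          "cofactor (kernel_mat K ?t) 0 j = cofactor (kernel_mat K2 ?t) 0 j" for j
    unfolding cofactor_def using del[of K K1 j] del[of K K2 j] assms(3) by auto
  have r: "kernel_mat K ?t $$ (0, j) = kernel_mat K1 ?t $$ (0, j) - kernel_mat K2 ?t $$ (0, j)" if "j < ?n" for j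
    using that assms(2)[of "?t ! j"] nth_mem[of j ?t] by (auto simp: kernel_mat_def simp del: set_simps nth_Cons)
  have "Determinant.det (kernel_mat K ?t) = (\<Sum>j<?n. kernel_mat K1 ?t $$ (0, j) * cofactor (kernel_mat K ?t) 0 j
      - kernel_mat K2 ?t $$ (0, j) * cofactor (kernel_mat K ?t) 0 j)"
    unfolding exp by (intro sum.cong) (auto simp: r left_diff_distrib simp del: length_Cons)
  also have "\<dots> = Determinant.det (kernel_mat K1 ?t) - Determinant.det (kernel_mat K2 ?t)"
    unfolding sum_subtractf exp using c by simp
  finally show ?thesis .
qed

text \<open>The analogue of \<open>det_kernel_mat_Cons\<close> for an empty site. In terms of a process with kernel \<open>K\<close>, both
  sides are the probability that \<open>s\<close> is occupied and \<open>i\<close> is not.\<close>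

lemma det_kernel_mat_hole_kernel:
  assumes "i \<notin> set s"
  assumes "K i i = 1 \<Longrightarrow> (\<forall>y\<in>set s. K i y = 0)"
  shows "(1 - K i i) * Determinant.det (kernel_mat (hole_kernel (schur_complement (hole_kernel K) i)) s) =
    Determinant.det (kernel_mat K s) - Determinant.det (kernel_mat K (i # s))"
proof -
  \<comment> \<open>Replace row \<open>i\<close> of \<open>K\<close> by that of \<open>1 - K\<close>; its Schur complement at \<open>i\<close> is the kernel on the left.\<close>
  define N where "N = (\<lambda>x y. if x = i then of_bool (y = i) - K i y else K x y)"
  \<comment> \<open>The contribution of the identity to this row; its only entry is the pivot, equal to \<open>1\<close>.\<close>
  define D where "D = (\<lambda>x y. if x = i then of_bool (y = i) else K x y)"
  have "(1 - K i i) * Determinant.det (kernel_mat (hole_kernel (schur_complement (hole_kernel K) i)) s)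
      = N i i * Determinant.det (kernel_mat (schur_complement N i) s)"
    using assms(1)
    by (auto simp: N_def hole_kernel_def schur_complement_def intro!: arg_cong[where f=Determinant.det] kernel_mat_cong)
  also have "\<dots> = Determinant.det (kernel_mat N (i # s))"
    using assms by (intro det_kernel_mat_Cons[symmetric]) (auto simp: N_def)
  also have "\<dots> = Determinant.det (kernel_mat D (i # s)) - Determinant.det (kernel_mat K (i # s))"
    using assms(1) by (intro det_kernel_mat_row_diff) (auto simp: N_def D_def)
  also have "Determinant.det (kernel_mat D (i # s)) = Determinant.det (kernel_mat K s)"
  proof -
    have "Determinant.det (kernel_mat D (i # s)) = Determinant.det (kernel_mat (schur_complement D i) s)"
      by (subst det_kernel_mat_Cons) (auto simp: D_def)
    also have "kernel_mat (schur_complement D i) s = kernel_mat K s"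
      using assms(1) by (auto simp: D_def schur_complement_def intro!: kernel_mat_cong)
    finally show ?thesis .
  qed
  finally show ?thesis .
qed

section \<open>Positive definite and contractive kernels\<close>

definition quad_form :: "'a set \<Rightarrow> ('a \<Rightarrow> 'a \<Rightarrow> complex) \<Rightarrow> ('a \<Rightarrow> complex) \<Rightarrow> complex" where
  "quad_form F K u = (\<Sum>x\<in>F. \<Sum>y\<in>F. K x y * u y * cnj (u x))"

definition psd_kernel :: "'a set \<Rightarrow> ('a \<Rightarrow> 'a \<Rightarrow> complex) \<Rightarrow> bool" where
  "psd_kernel I K \<longleftrightarrow> (\<forall>x\<in>I. \<forall>y\<in>I. K y x = cnj (K x y)) \<and>
     (\<forall>F u. finite F \<and> F \<subseteq> I \<longrightarrow> 0 \<le> Re (quad_form F K u))"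

text \<open>The condition \<open>0 \<le> K \<le> 1\<close> for all finite sections, in a form symmetric under exchanging
  \<open>K\<close> and \<open>1 - K\<close>.\<close>

definition contraction_kernel :: "'a set \<Rightarrow> ('a \<Rightarrow> 'a \<Rightarrow> complex) \<Rightarrow> bool" where
  "contraction_kernel I K \<longleftrightarrow> psd_kernel I K \<and> psd_kernel I (hole_kernel K)"

lemma hole_kernel_involutive [simp]: "hole_kernel (hole_kernel K) = K"
  by (simp add: hole_kernel_def fun_eq_iff)

lemma contraction_kernel_hole_kernel [simp]:
  "contraction_kernel I (hole_kernel K) \<longleftrightarrow> contraction_kernel I K"
  by (auto simp: contraction_kernel_def)

lemma psd_kernel_mono: "psd_kernel I K \<Longrightarrow> J \<subseteq> I \<Longrightarrow> psd_kernel J K"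
  unfolding psd_kernel_def by blast

lemma contraction_kernel_mono: "contraction_kernel I K \<Longrightarrow> J \<subseteq> I \<Longrightarrow> contraction_kernel J K"
  unfolding contraction_kernel_def using psd_kernel_mono[of I _ J] by auto

lemma psd_kernel_herm:
  assumes "psd_kernel I K" "x \<in> I" "y \<in> I"
  shows "K y x = cnj (K x y)"
  using assms(1)[unfolded psd_kernel_def, THEN conjunct1, THEN bspec, OF assms(2), THEN bspec, OF assms(3)] .

lemma psd_kernel_quad: "psd_kernel I K \<Longrightarrow> finite F \<Longrightarrow> F \<subseteq> I \<Longrightarrow> 0 \<le> Re (quad_form F K u)"
  unfolding psd_kernel_def by simp

lemma quad_form_hole_kernel:
  "quad_form F (hole_kernel K) u = (\<Sum>x\<in>F. of_real ((norm (u x))\<^sup>2)) - quad_form F K u" if "finite F"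
proof -
  have "(\<Sum>y\<in>F. hole_kernel K x y * u y * cnj (u x)) = of_real ((norm (u x))\<^sup>2) - (\<Sum>y\<in>F. K x y * u y * cnj (u x))"
    if "x \<in> F" for x
  proof -
    have "(\<Sum>y\<in>F. hole_kernel K x y * u y * cnj (u x)) =
      (\<Sum>y\<in>F. of_bool (x = y) * (u y * cnj (u x))) - (\<Sum>y\<in>F. K x y * u y * cnj (u x))"
      unfolding sum_subtractf[symmetric] by (intro sum.cong) (auto simp: hole_kernel_def algebra_simps)
    also have "(\<Sum>y\<in>F. of_bool (x = y) * (u y * cnj (u x))) = u x * cnj (u x)"
      using that \<open>finite F\<close> by (simp add: of_bool_def if_distrib[of "\<lambda>z. z * _"] cong: if_cong)
    finally show ?thesis by (simp only: complex_norm_square)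
  qed
  then show ?thesis by (simp add: quad_form_def sum_subtractf)
qed

lemma quad_form_real:
  assumes "psd_kernel I K" "F \<subseteq> I"
  shows "quad_form F K u \<in> \<real>"
proof -
  have "cnj (quad_form F K u) = (\<Sum>x\<in>F. \<Sum>y\<in>F. K y x * u x * cnj (u y))"
    unfolding quad_form_def cnj_sum
  proof (intro sum.cong refl)
    fix x y assume "x \<in> F" "y \<in> F"
    then have "x \<in> I" "y \<in> I" using assms(2) by auto
    then have "K y x = cnj (K x y)" by (rule psd_kernel_herm[OF assms(1)])
    then show "cnj (K x y * u y * cnj (u x)) = K y x * u x * cnj (u y)" by (simp add: mult_ac)
  qed
  also have "\<dots> = quad_form F K u"
    unfolding quad_form_def by (rule sum.swap)
  finally show ?thesis by (simp add: Reals_cnj_iff)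
qed

lemma psd_kernel_cnj_row:
  assumes "psd_kernel I K" "i \<in> I" "F \<subseteq> I"
  shows "cnj (\<Sum>y\<in>F. K i y * u y) = (\<Sum>x\<in>F. K x i * cnj (u x))"
  unfolding cnj_sum
proof (intro sum.cong refl)
  fix y assume "y \<in> F"
  then have "K y i = cnj (K i y)" by (intro psd_kernel_herm[OF assms(1,2)]) (use assms(3) in auto)
  then show "cnj (K i y * u y) = K y i * cnj (u y)" by simp
qed

lemma psd_kernel_diag:
  assumes "psd_kernel I K" "i \<in> I"
  shows "K i i \<in> \<real>" "0 \<le> Re (K i i)"
proof -
  show "K i i \<in> \<real>" using psd_kernel_herm[OF assms(1) assms(2) assms(2)] by (simp add: Reals_cnj_iff)
  show "0 \<le> Re (K i i)" using psd_kernel_quad[OF assms(1), of "{i}" "\<lambda>_. 1"] assms(2)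
    by (simp add: quad_form_def)
qed

lemma contraction_kernel_diag_le:
  assumes "contraction_kernel I K" "i \<in> I"
  shows "Re (K i i) \<le> 1"
  using psd_kernel_diag(2)[of I "hole_kernel K" i] assms
  by (auto simp: contraction_kernel_def hole_kernel_def)

text \<open>For a finite section this is \<open>K\<^sup>2 \<le> K\<close>: with \<open>v = K u\<close>, add the inequality \<open>0 \<le> K\<close> at \<open>u - v\<close> to
  the inequality \<open>K \<le> 1\<close> at \<open>v\<close>.\<close>

lemma contraction_kernel_norm:
  fixes u :: "'a \<Rightarrow> complex"
  assumes K: "contraction_kernel I K" and F: "finite F" "F \<subseteq> I"
  defines "v \<equiv> \<lambda>x. \<Sum>y\<in>F. K x y * u y"
  shows "(\<Sum>x\<in>F. (norm (v x))\<^sup>2) \<le> Re (quad_form F K u)"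
proof -
  have psd: "psd_kernel I K" "psd_kernel I (hole_kernel K)"
    using K by (auto simp: contraction_kernel_def)
  define N where "N = (\<Sum>x\<in>F. (norm (v x))\<^sup>2)"
  have N: "(\<Sum>x\<in>F. v x * cnj (v x)) = of_real N"
    unfolding N_def of_real_sum complex_norm_square ..
  have row: "(\<Sum>y\<in>F. K x y * (w y) * cnj (z x)) = (\<Sum>y\<in>F. K x y * w y) * cnj (z x)" for w z x
    by (simp add: sum_distrib_right)
  have left: "(\<Sum>x\<in>F. \<Sum>y\<in>F. K x y * v y * cnj (u x)) = of_real N"
  proof -
    have "(\<Sum>x\<in>F. \<Sum>y\<in>F. K x y * v y * cnj (u x)) = (\<Sum>y\<in>F. \<Sum>x\<in>F. K x y * v y * cnj (u x))"
      by (rule sum.swap)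
    also have "\<dots> = (\<Sum>y\<in>F. v y * cnj (v y))"
    proof (rule sum.cong[OF refl])
      fix y assume "y \<in> F"
      then have "cnj (v y) = (\<Sum>x\<in>F. K x y * cnj (u x))"
        unfolding v_def by (intro psd_kernel_cnj_row[OF psd(1)]) (use F in auto)
      then show "(\<Sum>x\<in>F. K x y * v y * cnj (u x)) = v y * cnj (v y)"
        by (simp add: sum_distrib_left mult_ac)
    qed
    finally show ?thesis by (simp only: N)
  qed
  have right: "(\<Sum>x\<in>F. \<Sum>y\<in>F. K x y * u y * cnj (v x)) = of_real N"
    unfolding row using N by (simp add: v_def)
  have "quad_form F K (\<lambda>x. u x - v x) = quad_form F K u
     - (\<Sum>x\<in>F. \<Sum>y\<in>F. K x y * v y * cnj (u x)) - (\<Sum>x\<in>F. \<Sum>y\<in>F. K x y * u y * cnj (v x)) + quad_form F K v"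
    unfolding quad_form_def sum_subtractf[symmetric] sum.distrib[symmetric]
    by (intro sum.cong refl) (simp add: algebra_simps)
  then have "0 \<le> Re (quad_form F K u) - 2 * N + Re (quad_form F K v)"
    using psd_kernel_quad[OF psd(1) F, of "\<lambda>x. u x - v x"] unfolding left right by simp
  moreover have "0 \<le> N - Re (quad_form F K v)"
    using psd_kernel_quad[OF psd(2) F, of v] unfolding quad_form_hole_kernel[OF F(1)]
    by (simp add: N_def)
  ultimately show ?thesis by (simp add: N_def)
qed

text \<open>The case of a unit vector. It makes all columns square summable, and it shows that a vanishing
  diagonal entry forces its row to vanish.\<close>

lemma contraction_kernel_col_le:
  assumes K: "contraction_kernel I K" and F: "finite F" "F \<subseteq> I" and i: "i \<in> I"
  shows "(\<Sum>x\<in>F. (norm (K x i))\<^sup>2) \<le> Re (K i i)"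
proof -
  let ?G = "insert i F"
  have d: "(\<Sum>y\<in>?G. K x y * of_bool (y = i)) = K x i" for x
    using F by (simp add: of_bool_def if_distrib[of "\<lambda>z. _ * z"] sum.remove[of ?G i] cong: if_cong)
  have "(\<Sum>x\<in>F. (norm (K x i))\<^sup>2) \<le> (\<Sum>x\<in>?G. (norm (K x i))\<^sup>2)"
    using F by (intro sum_mono2) auto
  also have "\<dots> \<le> Re (quad_form ?G K (\<lambda>y. of_bool (y = i)))"
    using contraction_kernel_norm[OF K, of ?G "\<lambda>y. of_bool (y = i)"] F i unfolding d by auto
  also have "quad_form ?G K (\<lambda>y. of_bool (y = i)) = (\<Sum>x\<in>?G. K x i * of_bool (x = i))"
    unfolding quad_form_def sum_distrib_right[symmetric] d by (intro sum.cong) auto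
  also have "\<dots> = K i i" using F
    by (simp add: of_bool_def if_distrib[of "\<lambda>z. _ * z"] sum.remove[of ?G i] cong: if_cong)
  finally show ?thesis .
qed

lemma contraction_kernel_zero_row:
  assumes K: "contraction_kernel I K" and i: "i \<in> I" "K i i = 0" and y: "y \<in> I"
  shows "K i y = 0"
proof -
  have "(norm (K y i))\<^sup>2 \<le> 0"
    using contraction_kernel_col_le[OF K, of "{y}" i] i y by simp
  then have "K y i = 0" by simp
  then show ?thesis using psd_kernel_herm[of I K y i] K i y by (auto simp: contraction_kernel_def)
qed

lemma contraction_kernel_one_row:
  assumes K: "contraction_kernel I K" and i: "i \<in> I" "K i i = 1" and y: "y \<in> I" "y \<noteq> i"
  shows "K i y = 0"
proof -
  have "hole_kernel K i y = 0"
    by (rule contraction_kernel_zero_row[of I "hole_kernel K"]) (use assms in \<open>simp_all, simp add: hole_kernel_def\<close>)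
  then show ?thesis using y(2) by (simp add: hole_kernel_def)
qed

text \<open>The Schur complement subtracts a rank-one positive form; in particular it decreases the form.\<close>

lemma quad_form_schur:
  assumes K: "psd_kernel (insert i J) K" and F: "finite F" "F \<subseteq> J"
  shows "quad_form F (schur_complement K i) u =
    quad_form F K u - of_real ((norm (\<Sum>y\<in>F. K i y * u y))\<^sup>2) / K i i"
proof -
  define c where "c = (\<Sum>y\<in>F. K i y * u y)"
  have cc: "cnj c = (\<Sum>x\<in>F. K x i * cnj (u x))"
    unfolding c_def by (rule psd_kernel_cnj_row[OF K]) (use F in auto)
  have "quad_form F (schur_complement K i) u = quad_form F K u - (\<Sum>x\<in>F. \<Sum>y\<in>F. (K x i * cnj (u x)) * (K i y * u y) / K i i)"
    unfolding quad_form_def sum_subtractf[symmetric] schur_complement_def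
    by (intro sum.cong refl) (simp add: algebra_simps)
  also have "(\<Sum>x\<in>F. \<Sum>y\<in>F. (K x i * cnj (u x)) * (K i y * u y) / K i i) = cnj c * c / K i i"
    unfolding cc unfolding c_def sum_product by (simp add: sum_divide_distrib)
  also have "cnj c * c = of_real ((norm c)\<^sup>2)"
    unfolding complex_norm_square by (rule mult.commute)
  finally show ?thesis unfolding c_def .
qed

text \<open>The form of the Schur complement is the minimum of the form of \<open>K\<close> over the coordinate at \<open>i\<close>,
  and the displayed value of that coordinate is the minimiser; so positivity is inherited.\<close>

lemma quad_form_schur_eq_quad_form:
  assumes K: "psd_kernel (insert i J) K" and F: "finite F" "F \<subseteq> J" "i \<notin> F" and nz: "K i i \<noteq> 0"
  shows "quad_form F (schur_complement K i) u =
    quad_form (insert i F) K (u(i := - (\<Sum>y\<in>F. K i y * u y) / K i i))"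
proof -
  define c where "c = (\<Sum>y\<in>F. K i y * u y)"
  define w where "w = u(i := - c / K i i)"
  define k where "k = K i i"
  have k: "k \<noteq> 0" "cnj k = k"
    using nz psd_kernel_diag(1)[OF K, of i] by (auto simp: k_def Reals_cnj_iff)
  have wF: "w y = u y" if "y \<in> F" for y using that F by (auto simp: w_def)
  have wi: "w i = - c / k" by (simp add: w_def k_def)
  have cc: "cnj c = (\<Sum>x\<in>F. K x i * cnj (u x))"
    unfolding c_def by (rule psd_kernel_cnj_row[OF K]) (use F in auto)
  have "quad_form (insert i F) K w =
    K i i * w i * cnj (w i) + (\<Sum>y\<in>F. K i y * w y * cnj (w i)) + (\<Sum>x\<in>F. K x i * w i * cnj (w x)) + (\<Sum>x\<in>F. \<Sum>y\<in>F. K x y * w y * cnj (w x))"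
    using F by (simp add: quad_form_def sum.distrib)
  also have "(\<Sum>y\<in>F. K i y * w y * cnj (w i)) = c * cnj (w i)"
    unfolding c_def sum_distrib_right by (intro sum.cong) (auto simp: wF)
  also have "(\<Sum>x\<in>F. K x i * w i * cnj (w x)) = w i * cnj c"
    unfolding cc sum_distrib_left by (intro sum.cong) (auto simp: wF)
  also have "(\<Sum>x\<in>F. \<Sum>y\<in>F. K x y * w y * cnj (w x)) = quad_form F K u"
    unfolding quad_form_def by (intro sum.cong) (auto simp: wF)
  also have "K i i * w i * cnj (w i) + c * cnj (w i) + w i * cnj c = - (c * cnj c / k)"
    using k unfolding wi k_def[symmetric] by (simp add: field_simps)
  also have "- (c * cnj c / k) + quad_form F K u = quad_form F (schur_complement K i) u"
    unfolding quad_form_schur[OF K F(1,2)] complex_norm_square c_def k_def by simp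
  finally show ?thesis unfolding w_def c_def by (rule sym)
qed

text \<open>Conditioning stays inside the class of contractive kernels: the lower bound comes from
  minimising over the coordinate \<open>i\<close>, the upper bound from the form getting smaller.\<close>

lemma contraction_kernel_schur:
  assumes K: "contraction_kernel (insert i J) K" and i: "i \<notin> J"
  shows "contraction_kernel J (schur_complement K i)"
proof (cases "K i i = 0")
  case True
  then have "schur_complement K i = K" by (simp add: schur_complement_def)
  then show ?thesis using contraction_kernel_mono[OF K] by auto
next
  case False
  have psd: "psd_kernel (insert i J) K" "psd_kernel (insert i J) (hole_kernel K)"
    using K by (auto simp: contraction_kernel_def)
  obtain k where k: "K i i = of_real k" "0 < k"
    using psd_kernel_diag[OF psd(1), of i] False by (auto elim!: Reals_cases)
  have herm: "schur_complement K i y x = cnj (schur_complement K i x y)" if "x \<in> J" "y \<in> J" for x y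
    using that psd_kernel_herm[OF psd(1), of x y] psd_kernel_herm[OF psd(1), of i y]
      psd_kernel_herm[OF psd(1), of x i]
    by (simp add: schur_complement_def k(1))
  have nn: "0 \<le> Re (quad_form F (schur_complement K i) u)" if F: "finite F" "F \<subseteq> J" for F u
  proof -
    have iF: "i \<notin> F" "insert i F \<subseteq> insert i J" "finite (insert i F)" using F i by auto
    show ?thesis
      unfolding quad_form_schur_eq_quad_form[OF psd(1) F iF(1) False]
      by (rule psd_kernel_quad[OF psd(1) iF(3,2)])
  qed
  have le: "0 \<le> Re (quad_form F (hole_kernel (schur_complement K i)) u)" if F: "finite F" "F \<subseteq> J" for F u
  proof -
    have "Re (quad_form F (schur_complement K i) u) \<le> Re (quad_form F K u)"
      unfolding quad_form_schur[OF psd(1) F] k(1) using k(2)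
      by (simp del: of_real_power of_real_sum of_real_divide add: of_real_divide[symmetric])
    moreover have "0 \<le> Re (quad_form F (hole_kernel K) u)"
      using psd_kernel_quad[OF psd(2) F(1)] F(2) by auto
    ultimately show ?thesis using F by (simp add: quad_form_hole_kernel)
  qed
  have herm': "hole_kernel (schur_complement K i) y x = cnj (hole_kernel (schur_complement K i) x y)" if "x \<in> J" "y \<in> J" for x y
    unfolding hole_kernel_def herm[OF that] by auto
  show ?thesis
    unfolding contraction_kernel_def psd_kernel_def by (intro conjI ballI allI impI herm herm' nn le) auto
qed

section \<open>Sampling a determinantal process on finitely many sites\<close>

text \<open>The principal minor of \<open>K\<close> on a finite set. Any enumeration gives the same value
  (\<open>correlation_set\<close>).\<close>

definition correlation :: "('a \<Rightarrow> 'a \<Rightarrow> complex) \<Rightarrow> 'a set \<Rightarrow> complex" where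
  "correlation K T = Determinant.det (kernel_mat K (SOME s. distinct s \<and> set s = T))"

lemma correlation_set:
  assumes "distinct s"
  shows "correlation K (set s) = Determinant.det (kernel_mat K s)"
proof -
  have "\<exists>t. distinct t \<and> set t = set s" using assms by blast
  from someI_ex[OF this] show ?thesis
    unfolding correlation_def using assms by (intro det_kernel_mat_perm) auto
qed

lemma correlation_empty [simp]: "correlation K {} = 1"
proof -
  have "kernel_mat K [] \<in> carrier_mat 0 0" by (simp add: kernel_mat_def)
  then show ?thesis using correlation_set[of "[]" K] det_dim_zero by simp
qed

text \<open>Together these say that the minor on \<open>T\<close> is the average, over the bit at \<open>i\<close>, of the minors of
  the two conditioned kernels.\<close>

lemma correlation_insert:
  assumes K: "contraction_kernel (insert i T) K" and T: "finite T" "i \<notin> T"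
  shows "correlation K (insert i T) = K i i * correlation (schur_complement K i) T"
    and "correlation K T = correlation K (insert i T) +
      (1 - K i i) * correlation (hole_kernel (schur_complement (hole_kernel K) i)) T"
proof -
  obtain s where s: "distinct s" "set s = T" using finite_distinct_list[OF T(1)] by blast
  then have is_: "distinct (i # s)" "set (i # s) = insert i T" using T by auto
  have c: "correlation L T = Determinant.det (kernel_mat L s)"
       "correlation L (insert i T) = Determinant.det (kernel_mat L (i # s))" for L
    using correlation_set[OF s(1), of L] correlation_set[OF is_(1), of L] s(2) by auto
  show "correlation K (insert i T) = K i i * correlation (schur_complement K i) T"
    unfolding c by (rule det_kernel_mat_Cons) (use contraction_kernel_zero_row[OF K] s in auto)
  show "correlation K T = correlation K (insert i T) +
      (1 - K i i) * correlation (hole_kernel (schur_complement (hole_kernel K) i)) T"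
    unfolding c using contraction_kernel_one_row[OF K] s T
    by (subst det_kernel_mat_hole_kernel) auto
qed

lemma prob_bind_bernoulli:
  assumes "0 \<le> r" "r \<le> 1"
  shows "measure_pmf.prob (bind_pmf (bernoulli_pmf r) p) A =
    r * measure_pmf.prob (p True) A + (1 - r) * measure_pmf.prob (p False) A"
proof -
  have "ennreal (measure_pmf.prob (bind_pmf (bernoulli_pmf r) p) A) =
    ennreal (measure_pmf.prob (p True) A) * ennreal r + ennreal (measure_pmf.prob (p False) A) * ennreal (1 - r)"
    unfolding measure_pmf.emeasure_eq_measure[symmetric] emeasure_bind_pmf
    by (rule nn_integral_bernoulli_pmf) (use assms in auto)
  also have "\<dots> = ennreal (r * measure_pmf.prob (p True) A + (1 - r) * measure_pmf.prob (p False) A)"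
    using assms by (simp add: ennreal_mult'' ennreal_plus mult.commute)
  finally show ?thesis using assms by (subst (asm) ennreal_inj) auto
qed

text \<open>The induction adds one site, which is sampled before the others: toss a coin with success
  probability \<open>K i i\<close>, then use the induction hypothesis for the kernel conditioned on the outcome.
  That the sampled sets stay inside \<open>J\<close> is part of the induction because a set sampled without the
  site \<open>i\<close> must not contain it.\<close>

lemma determinantal_pmf_exists:
  assumes "finite J" "contraction_kernel J K"
  shows "\<exists>p. set_pmf p \<subseteq> Pow J \<and>
    (\<forall>T\<subseteq>J. complex_of_real (measure_pmf.prob p {S. T \<subseteq> S}) = correlation K T)"
  using assms
proof (induction J arbitrary: K rule: finite_induct)
  case empty
  have "complex_of_real (measure_pmf.prob (return_pmf {}) {S. T \<subseteq> S}) = correlation K T" if "T \<subseteq> {}" for T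
    using that by simp
  then show ?case by (intro exI[of _ "return_pmf {}"]) auto
next
  case (insert i J)
  let ?K1 = "schur_complement K i" and ?K0 = "hole_kernel (schur_complement (hole_kernel K) i)"
  have K1: "contraction_kernel J ?K1"
    using contraction_kernel_schur[OF insert.prems] insert.hyps by auto
  have K0: "contraction_kernel J ?K0"
    using contraction_kernel_schur[of i J "hole_kernel K"] insert.prems insert.hyps by auto
  obtain p1 where p1: "set_pmf p1 \<subseteq> Pow J"
    "\<And>T. T \<subseteq> J \<Longrightarrow> complex_of_real (measure_pmf.prob p1 {S. T \<subseteq> S}) = correlation ?K1 T"
    using insert.IH[OF K1] by auto
  obtain p0 where p0: "set_pmf p0 \<subseteq> Pow J"
    "\<And>T. T \<subseteq> J \<Longrightarrow> complex_of_real (measure_pmf.prob p0 {S. T \<subseteq> S}) = correlation ?K0 T"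
    using insert.IH[OF K0] by auto
  define k where "k = Re (K i i)"
  have psd: "psd_kernel (insert i J) K" using insert.prems by (auto simp: contraction_kernel_def)
  have k: "K i i = of_real k" "0 \<le> k" "k \<le> 1"
    using psd_kernel_diag[OF psd, of i] contraction_kernel_diag_le[OF insert.prems, of i]
    by (auto simp: k_def)
  define p where "p = bind_pmf (bernoulli_pmf k) (\<lambda>b. if b then map_pmf (insert i) p1 else p0)"
  have pr: "measure_pmf.prob p A = k * measure_pmf.prob p1 (insert i -` A) + (1 - k) * measure_pmf.prob p0 A" for A
    unfolding p_def prob_bind_bernoulli[OF k(2,3)] by simp
  have one: "complex_of_real (measure_pmf.prob p1 (insert i -` {S. T \<subseteq> S})) = correlation ?K1 (T - {i})"
    if "T \<subseteq> insert i J" for T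
  proof -
    have "insert i -` {S. T \<subseteq> S} = {S. T - {i} \<subseteq> S}" by auto
    then show ?thesis using p1(2)[of "T - {i}"] that by auto
  qed
  have "set_pmf p \<subseteq> Pow (insert i J)"
  proof
    fix S assume "S \<in> set_pmf p"
    then consider "S \<in> insert i ` set_pmf p1" | "S \<in> set_pmf p0"
      unfolding p_def by (auto split: if_splits)
    then show "S \<in> Pow (insert i J)" using p1(1) p0(1) by cases auto
  qed
  moreover have "complex_of_real (measure_pmf.prob p {S. T \<subseteq> S}) = correlation K T"
    if T: "T \<subseteq> insert i J" for T
  proof (cases "i \<in> T")
    case True
    have KT: "contraction_kernel (insert i (T - {i})) K"
      using contraction_kernel_mono[OF insert.prems] T by auto
    have fT: "finite (T - {i})" using T insert.hyps(1) finite_subset by fastforce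
    have "measure_pmf.prob p0 {S. T \<subseteq> S} = 0"
      unfolding measure_pmf_zero_iff using p0(1) insert.hyps(2) True by auto
    then have "complex_of_real (measure_pmf.prob p {S. T \<subseteq> S}) = K i i * correlation ?K1 (T - {i})"
      unfolding pr one[OF T, symmetric] by (simp add: k)
    also have "\<dots> = correlation K (insert i (T - {i}))"
      using correlation_insert(1)[OF KT fT] by simp
    finally show ?thesis using True by (simp add: insert_absorb)
  next
    case False
    have KT: "contraction_kernel (insert i T) K"
      using contraction_kernel_mono[OF insert.prems] T by auto
    have fT: "finite T" using T insert.hyps(1) finite_subset by fastforce
    have "T \<subseteq> J" using T False by auto
    then have "complex_of_real (measure_pmf.prob p {S. T \<subseteq> S}) =
        K i i * correlation ?K1 T + (1 - K i i) * correlation ?K0 T"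
      unfolding pr using one[OF T] p0(2)[of T] False by (simp add: k)
    also have "\<dots> = correlation K T"
      using correlation_insert[OF KT fT False] by simp
    finally show ?thesis .
  qed
  ultimately show ?case by blast
qed

section \<open>Laws of processes of bits\<close>

definition all_ones :: "'i set \<Rightarrow> 'i set \<Rightarrow> ('i \<Rightarrow> nat) set" where
  "all_ones I S = {\<omega> \<in> space (PiM I (\<lambda>_. bit_space)). \<forall>i\<in>S. \<omega> i = 1}"

text \<open>For bits, the events that a coordinate equals \<open>1\<close> already generate everything, and finite
  intersections of them turn the generator into a \<open>\<pi>\<close>-system.\<close>

lemma sets_bit_PiM:
  "sets (PiM I (\<lambda>_. bit_space)) =
    sigma_sets (space (PiM I (\<lambda>_. bit_space))) {all_ones I S | S. finite S \<and> S \<subseteq> I}"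
  (is "_ = sigma_sets ?\<Omega> ?E")
proof -
  let ?G = "{{f \<in> ?\<Omega>. f i \<in> A} | i A. i \<in> I \<and> A \<in> sets bit_space}"
  have eq: "sets (PiM I (\<lambda>_. bit_space)) = sigma_sets ?\<Omega> ?G"
    unfolding sets_PiM_single space_PiM by simp
  show ?thesis unfolding eq
  proof (rule sigma_sets_eqI)
    fix a assume "a \<in> ?G"
    then obtain i A where a: "a = {f \<in> ?\<Omega>. f i \<in> A}" "i \<in> I" "A \<subseteq> {0, 1}" by auto
    have E: "all_ones I {i} \<in> sigma_sets ?\<Omega> ?E" using a(2) by (intro sigma_sets.Basic) auto
    have bit: "f i \<in> {0, 1}" if "f \<in> ?\<Omega>" for f using that a(2) by (auto simp: space_PiM)
    have "A \<in> {{}, {0}, {1}, {0, 1}}" using a(3) by (simp add: Pow_insert flip: Pow_iff) blast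
    then consider "A = {}" | "A = {0}" | "A = {1}" | "A = {0, 1}" by blast
    then show "a \<in> sigma_sets ?\<Omega> ?E"
    proof cases
      case 1 then show ?thesis using a(1) by (simp add: sigma_sets.Empty)
    next
      case 2
      then have "a = ?\<Omega> - all_ones I {i}" using a(1) bit by (auto simp: all_ones_def)
      then show ?thesis using E by (simp add: sigma_sets.Compl)
    next
      case 3
      then have "a = all_ones I {i}" using a(1) by (auto simp: all_ones_def)
      then show ?thesis using E by simp
    next
      case 4
      then have "a = ?\<Omega>" using a(1) bit by auto
      then show ?thesis by (simp add: sigma_sets_top)
    qed
  next
    fix b assume "b \<in> ?E"
    then obtain S where S: "b = all_ones I S" "finite S" "S \<subseteq> I" by auto
    have "all_ones I S \<in> sets (PiM I (\<lambda>_. bit_space))"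
      unfolding all_ones_def using S(2,3)
    proof (intro sets.sets_Collect_finite_All)
      fix i assume "i \<in> S"
      then have "i \<in> I" using S(3) by auto
      have "(\<lambda>\<omega>. \<omega> i) -` {1} \<inter> ?\<Omega> \<in> sets (PiM I (\<lambda>_. bit_space))"
        by (rule measurable_sets[OF measurable_component_singleton[OF \<open>i \<in> I\<close>]]) simp
      also have "(\<lambda>\<omega>. \<omega> i) -` {1} \<inter> ?\<Omega> = {\<omega> \<in> ?\<Omega>. \<omega> i = 1}" by auto
      finally show "{\<omega> \<in> ?\<Omega>. \<omega> i = 1} \<in> sets (PiM I (\<lambda>_. bit_space))" .
    qed auto
    then show "b \<in> sigma_sets ?\<Omega> ?G" unfolding S(1) eq .
  qed
qed

lemma all_ones_sets: "finite S \<Longrightarrow> S \<subseteq> I \<Longrightarrow> all_ones I S \<in> sets (PiM I (\<lambda>_. bit_space))"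
  unfolding sets_bit_PiM by (rule sigma_sets.Basic) auto

lemma bit_measure_eqI:
  assumes "prob_space P" "prob_space Q"
    and sets: "sets P = sets (PiM I (\<lambda>_. bit_space))" "sets Q = sets (PiM I (\<lambda>_. bit_space))"
    and eq: "\<And>S. finite S \<Longrightarrow> S \<subseteq> I \<Longrightarrow> measure P (all_ones I S) = measure Q (all_ones I S)"
  shows "P = Q"
proof (rule measure_eqI_generator_eq)
  let ?\<Omega> = "space (PiM I (\<lambda>_. bit_space))"
  let ?E = "{all_ones I S | S. finite S \<and> S \<subseteq> I}"
  interpret P: prob_space P by fact
  interpret Q: prob_space Q by fact
  show "Int_stable ?E"
  proof (rule Int_stableI)
    fix a b assume "a \<in> ?E" "b \<in> ?E"
    then obtain S T where *: "a = all_ones I S" "b = all_ones I T" "finite S" "S \<subseteq> I" "finite T" "T \<subseteq> I" by auto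
    then have "a \<inter> b = all_ones I (S \<union> T)" by (auto simp: all_ones_def)
    with * show "a \<inter> b \<in> ?E" by auto
  qed
  show "?E \<subseteq> Pow ?\<Omega>" by (auto simp: all_ones_def)
  show "emeasure P X = emeasure Q X" if "X \<in> ?E" for X
    using that eq by (auto simp: P.emeasure_eq_measure Q.emeasure_eq_measure)
  show "sets P = sigma_sets ?\<Omega> ?E" "sets Q = sigma_sets ?\<Omega> ?E"
    unfolding sets sets_bit_PiM by simp_all
  show "range (\<lambda>_::nat. all_ones I {}) \<subseteq> ?E" by auto
  show "\<Union> (range (\<lambda>_::nat. all_ones I {})) = ?\<Omega>" by (auto simp: all_ones_def)
  show "emeasure P (all_ones I {}) \<noteq> \<infinity>" for i :: nat by simp
qed

lemma bit_process_measurable: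
  "bit_process M I X \<Longrightarrow> (\<lambda>\<omega>. \<lambda>i\<in>I. X i \<omega>) \<in> measurable M (PiM I (\<lambda>_. bit_space))"
  unfolding bit_process_def by (auto intro: measurable_restrict)

lemma prob_space_process_law: "bit_process M I X \<Longrightarrow> prob_space (process_law M I X)"
  unfolding process_law_def
  using bit_process_measurable[of M I X] by (auto simp: bit_process_def intro: prob_space.prob_space_distr)

lemma sets_process_law [simp]: "sets (process_law M I X) = sets (PiM I (\<lambda>_. bit_space))"
  by (simp add: process_law_def)

lemma space_process_law [simp]: "space (process_law M I X) = space (PiM I (\<lambda>_. bit_space))"
  by (simp add: process_law_def)

lemma measure_process_law:
  assumes "bit_process M I X" "finite S" "S \<subseteq> I"
  shows "measure (process_law M I X) (all_ones I S) = measure M {\<omega> \<in> space M. \<forall>i\<in>S. X i \<omega> = 1}"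
proof -
  have "(\<lambda>\<omega>. \<lambda>i\<in>I. X i \<omega>) -` all_ones I S \<inter> space M = {\<omega> \<in> space M. \<forall>i\<in>S. X i \<omega> = 1}"
    using assms measurable_space[OF bit_process_measurable[OF assms(1)]]
    by (auto simp: all_ones_def subset_iff)
  then show ?thesis
    unfolding process_law_def
    by (subst measure_distr[OF bit_process_measurable[OF assms(1)] all_ones_sets[OF assms(2,3)]]) simp
qed

lemma process_law_eqI:
  assumes "bit_process M I X" "bit_process N I Y"
    and "\<And>S. finite S \<Longrightarrow> S \<subseteq> I \<Longrightarrow>
      measure M {\<omega> \<in> space M. \<forall>i\<in>S. X i \<omega> = 1} = measure N {\<omega> \<in> space N. \<forall>i\<in>S. Y i \<omega> = 1}"
  shows "process_law M I X = process_law N I Y"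
  using assms by (intro bit_measure_eqI[of _ _ I]) (auto simp: measure_process_law prob_space_process_law)

section \<open>Determinantal processes on arbitrary index sets\<close>

text \<open>Lists are traded for sets, and the empty set, where both sides are \<open>1\<close>, is included.\<close>

lemma determinantal_process_iff:
  "determinantal_process M I K X \<longleftrightarrow> bit_process M I X \<and>
    (\<forall>S. finite S \<and> S \<subseteq> I \<longrightarrow> complex_of_real (measure M {\<omega> \<in> space M. \<forall>i\<in>S. X i \<omega> = 1}) = correlation K S)"
proof
  assume D: "determinantal_process M I K X"
  then have b: "bit_process M I X" by (simp add: determinantal_process_def)
  have "complex_of_real (measure M {\<omega> \<in> space M. \<forall>i\<in>S. X i \<omega> = 1}) = correlation K S"
    if S: "finite S" "S \<subseteq> I" for S
  proof (cases "S = {}")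
    case True
    then show ?thesis using b by (simp add: bit_process_def prob_space.prob_space)
  next
    case False
    obtain s where s: "distinct s" "set s = S" using finite_distinct_list[OF S(1)] by blast
    then have "s \<noteq> []" using False by auto
    then show ?thesis
      using D s S correlation_set[OF s(1), of K] unfolding determinantal_process_def kernel_mat_def by auto
  qed
  then show "bit_process M I X \<and>
    (\<forall>S. finite S \<and> S \<subseteq> I \<longrightarrow> complex_of_real (measure M {\<omega> \<in> space M. \<forall>i\<in>S. X i \<omega> = 1}) = correlation K S)"
    using b by blast
next
  assume "bit_process M I X \<and>
    (\<forall>S. finite S \<and> S \<subseteq> I \<longrightarrow> complex_of_real (measure M {\<omega> \<in> space M. \<forall>i\<in>S. X i \<omega> = 1}) = correlation K S)"
  then show "determinantal_process M I K X"
    unfolding determinantal_process_def kernel_mat_def[symmetric] by (auto simp: correlation_set)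
qed

lemma determinantal_process_law:
  assumes "determinantal_process M I K X"
  shows "determinantal_process (process_law M I X) I K (\<lambda>i \<omega>. \<omega> i)"
proof -
  have b: "bit_process M I X" using assms by (simp add: determinantal_process_def)
  have "bit_process (process_law M I X) I (\<lambda>i \<omega>. \<omega> i)"
    unfolding bit_process_def using prob_space_process_law[OF b]
    by (auto simp: process_law_def intro: measurable_component_singleton)
  moreover have "{\<omega> \<in> space (PiM I (\<lambda>_. bit_space)). \<forall>i\<in>S. \<omega> i = 1} = all_ones I S" for S
    by (simp add: all_ones_def)
  ultimately show ?thesis
    using assms measure_process_law[OF b] unfolding determinantal_process_iff by simp
qed

lemma determinantal_law_unique:
  assumes "sets P = sets (PiM I (\<lambda>_. bit_space))" "determinantal_process P I K (\<lambda>i \<omega>. \<omega> i)"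
    and "sets Q = sets (PiM I (\<lambda>_. bit_space))" "determinantal_process Q I K (\<lambda>i \<omega>. \<omega> i)"
  shows "P = Q"
proof (rule bit_measure_eqI[of P Q I])
  show "measure P (all_ones I S) = measure Q (all_ones I S)" if S: "finite S" "S \<subseteq> I" for S
  proof -
    have "complex_of_real (measure P (all_ones I S)) = complex_of_real (measure Q (all_ones I S))"
      using assms S sets_eq_imp_space_eq[OF assms(1)] sets_eq_imp_space_eq[OF assms(3)]
      unfolding determinantal_process_iff all_ones_def by simp
    then show ?thesis by (simp only: of_real_eq_iff)
  qed
qed (use assms in \<open>auto simp: determinantal_process_def bit_process_def\<close>)

text \<open>The finite-dimensional laws are consistent because each of them is determined by its inclusion
  probabilities, which do not mention the ambient finite set. The extension theorem is applied to
  real-valued processes, as it asks for a Polish state space; the limit is then mapped back to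
  bits.\<close>

theorem determinantal_law_exists:
  fixes K :: "'i \<Rightarrow> 'i \<Rightarrow> complex"
  assumes K: "contraction_kernel I K"
  shows "\<exists>P. sets P = sets (PiM I (\<lambda>_. bit_space)) \<and> determinantal_process P I K (\<lambda>i \<omega>. \<omega> i)"
proof -
  have "\<forall>J. \<exists>p. finite J \<and> J \<subseteq> I \<longrightarrow>
      (\<forall>T\<subseteq>J. complex_of_real (measure_pmf.prob p {S. T \<subseteq> S}) = correlation K T)"
    using determinantal_pmf_exists contraction_kernel_mono[OF K] by meson
  then obtain p where p: "\<And>J T. finite J \<Longrightarrow> J \<subseteq> I \<Longrightarrow> T \<subseteq> J \<Longrightarrow>
      complex_of_real (measure_pmf.prob (p J) {S. T \<subseteq> S}) = correlation K T"
    by metis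
  define B :: "'i set \<Rightarrow> ('i \<Rightarrow> real) measure" where "B J = PiM J (\<lambda>_. borel)" for J
  define R :: "'i set \<Rightarrow> 'i set \<Rightarrow> 'i \<Rightarrow> real" where "R J = (\<lambda>S. \<lambda>i\<in>J. of_bool (i \<in> S))" for J
  define P where "P J = distr (measure_pmf (p J)) (B J) (R J)" for J
  have R: "R J \<in> measurable (measure_pmf q) (B J)" for J q
    unfolding R_def B_def by (auto simp: space_PiM)
  have bp: "bit_process (measure_pmf q) J (\<lambda>i S. of_bool (i \<in> S))" for J :: "'i set" and q
    by (auto simp: bit_process_def measure_pmf.prob_space_axioms)
  have proj: "distr (measure_pmf (p H)) (B J) (R J) = P J" if "J \<subseteq> H" "finite H" "H \<subseteq> I" for J H
  proof -
    have fJ: "finite J" "J \<subseteq> I" using that finite_subset by auto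
    have law: "process_law (measure_pmf (p H)) J (\<lambda>i S. of_bool (i \<in> S)) =
      process_law (measure_pmf (p J)) J (\<lambda>i S. of_bool (i \<in> S))"
    proof (rule process_law_eqI[OF bp bp])
      fix T assume T: "finite T" "T \<subseteq> J"
      have *: "{S \<in> space (measure_pmf q). \<forall>i\<in>T. of_bool (i \<in> S) = (1::nat)} = {S. T \<subseteq> S}" for q by auto
      have "complex_of_real (measure_pmf.prob (p H) {S. T \<subseteq> S}) = complex_of_real (measure_pmf.prob (p J) {S. T \<subseteq> S})"
        using p[of H T] p[of J T] that fJ T by auto
      then show "measure_pmf.prob (p H) {S \<in> space (measure_pmf (p H)). \<forall>i\<in>T. of_bool (i \<in> S) = (1::nat)} =
        measure_pmf.prob (p J) {S \<in> space (measure_pmf (p J)). \<forall>i\<in>T. of_bool (i \<in> S) = (1::nat)}"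
        unfolding * by (simp only: of_real_eq_iff)
    qed
    have m: "(\<lambda>\<omega>. \<lambda>i\<in>J. real (\<omega> i)) \<in> measurable (PiM J (\<lambda>_. bit_space)) (B J)"
      unfolding B_def
      by (intro measurable_restrict measurable_compose[OF measurable_component_singleton]) auto
    have "distr (process_law (measure_pmf q) J (\<lambda>i S. of_bool (i \<in> S))) (B J) (\<lambda>\<omega>. \<lambda>i\<in>J. real (\<omega> i))
      = distr (measure_pmf q) (B J) (R J)" for q
      unfolding process_law_def
      by (subst distr_distr[OF m bit_process_measurable[OF bp]])
        (auto intro!: distr_cong simp: R_def fun_eq_iff)
    then show ?thesis using law unfolding P_def by metis
  qed
  interpret polish_projective I P
  proof (intro polish_projective.intro projective_family.intro)
    fix J H assume JH: "J \<subseteq> H" "finite H" "H \<subseteq> I"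
    have r: "(\<lambda>f. restrict f J) \<in> measurable (B H) (B J)"
      unfolding B_def by (rule measurable_restrict_subset[OF JH(1)])
    have "distr (P H) (PiM J (\<lambda>_. borel)) (\<lambda>f. restrict f J) = distr (measure_pmf (p H)) (B J) (R J)"
      unfolding P_def B_def[symmetric] using JH(1)
      by (subst distr_distr[OF r R]) (auto intro!: distr_cong simp: R_def fun_eq_iff)
    then show "P J = distr (P H) (PiM J (\<lambda>_. borel)) (\<lambda>f. restrict f J)"
      using proj[OF JH] by simp
  next
    show "prob_space (P J)" for J
      unfolding P_def by (rule measure_pmf.prob_space_distr[OF R])
  qed
  define X where "X = (\<lambda>i (\<omega> :: 'i \<Rightarrow> real). of_bool (\<omega> i = 1) :: nat)"
  have sl: "sets lim = sets (PiM I (\<lambda>_. borel))" by simp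
  have X: "X i \<in> measurable lim bit_space" if "i \<in> I" for i
  proof -
    have "(\<lambda>x :: real. of_bool (x = 1) :: nat) \<in> measurable borel bit_space"
    proof (rule measurableI)
      fix A assume "A \<in> sets bit_space"
      have "(\<lambda>x :: real. of_bool (x = 1) :: nat) -` A = (if 1 \<in> A then {1} else {}) \<union> (if 0 \<in> A then - {1} else {})"
        by (auto simp: of_bool_def split: if_splits)
      then show "(\<lambda>x :: real. of_bool (x = 1) :: nat) -` A \<inter> space borel \<in> sets borel" by simp
    qed auto
    moreover have "(\<lambda>\<omega>. \<omega> i) \<in> measurable lim borel"
      using measurable_component_singleton[OF that, of "\<lambda>_. borel :: real measure"]
        measurable_cong_sets[OF sl refl] by blast
    ultimately show ?thesis unfolding X_def by (rule measurable_compose[rotated])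
  qed
  have bX: "bit_process lim I X"
    unfolding bit_process_def using X P.prob_space_axioms by auto
  have "determinantal_process lim I K X"
    unfolding determinantal_process_iff
  proof (intro conjI allI impI bX)
    fix S assume S: "finite S \<and> S \<subseteq> I"
    define A where "A = {x \<in> extensional S. \<forall>i\<in>S. x i = (1 :: real)}"
    have "A = (\<Pi>\<^sub>E i\<in>S. {1})" unfolding A_def set_eq_iff PiE_iff by auto
    then have A: "A \<in> sets (PiM S (\<lambda>_. borel))"
      using S by (simp only:) (intro sets_PiM_I_finite; simp)
    have "{\<omega> \<in> space lim. \<forall>i\<in>S. X i \<omega> = 1} = emb I S A"
      using S sets_eq_imp_space_eq[OF sl]
      by (auto simp: X_def A_def prod_emb_def space_PiM PiE_iff extensional_def)
    then have "measure lim {\<omega> \<in> space lim. \<forall>i\<in>S. X i \<omega> = 1} = measure (P S) A"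
      using measure_lim_emb[of S A] S A by simp
    also have "\<dots> = measure_pmf.prob (p S) {T. S \<subseteq> T}"
    proof -
      have "R S -` A \<inter> space (measure_pmf (p S)) = {T. S \<subseteq> T}"
        by (auto simp: R_def A_def split: if_splits)
      then show ?thesis
        unfolding P_def using A by (subst measure_distr[OF R]) (auto simp: B_def)
    qed
    finally show "complex_of_real (measure lim {\<omega> \<in> space lim. \<forall>i\<in>S. X i \<omega> = 1}) = correlation K S"
      using p[of S S] S by simp
  qed
  from determinantal_process_law[OF this] show ?thesis
    by (intro exI[of _ "process_law lim I X"]) simp
qed

lemma determinantal_process_law_eq:
  assumes "determinantal_process M I K X" "determinantal_process N I K Y"
  shows "process_law M I X = process_law N I Y"
proof (rule process_law_eqI)
  show "bit_process M I X" "bit_process N I Y" using assms by (auto simp: determinantal_process_def)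
  fix S assume S: "finite S" "S \<subseteq> I"
  have "complex_of_real (measure M {\<omega> \<in> space M. \<forall>i\<in>S. X i \<omega> = 1}) = complex_of_real (measure N {\<omega> \<in> space N. \<forall>i\<in>S. Y i \<omega> = 1})"
    using assms S unfolding determinantal_process_iff by simp
  then show "measure M {\<omega> \<in> space M. \<forall>i\<in>S. X i \<omega> = 1} = measure N {\<omega> \<in> space N. \<forall>i\<in>S. Y i \<omega> = 1}"
    by (simp only: of_real_eq_iff)
qed

text \<open>Observing a process along an injective map of indices pulls the kernel back. Rays, shifts of
  rays and automorphisms are all instances.\<close>

lemma determinantal_process_reindex:
  assumes D: "determinantal_process M I K X"
    and \<phi>: "inj_on \<phi> J" "\<phi> ` J \<subseteq> I"
    and K': "\<And>x y. x \<in> J \<Longrightarrow> y \<in> J \<Longrightarrow> K (\<phi> x) (\<phi> y) = K' x y"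
  shows "determinantal_process M J K' (\<lambda>j. X (\<phi> j))"
  unfolding determinantal_process_iff
proof (intro conjI allI impI)
  show "bit_process M J (\<lambda>j. X (\<phi> j))"
    using D \<phi> unfolding determinantal_process_def bit_process_def by auto
  fix S assume S: "finite S \<and> S \<subseteq> J"
  obtain s where s: "distinct s" "set s = S" using finite_distinct_list S by blast
  have "distinct (map \<phi> s)" using s S \<phi>(1) by (auto simp: distinct_map intro: inj_on_subset)
  then have "correlation K (\<phi> ` S) = Determinant.det (kernel_mat K (map \<phi> s))"
    using correlation_set[of "map \<phi> s" K] s by simp
  also have "kernel_mat K (map \<phi> s) = kernel_mat K' s"
    unfolding kernel_mat_def length_map using s S K' by (intro cong_mat) (auto simp: subset_iff)
  also have "Determinant.det \<dots> = correlation K' S"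
    using correlation_set[of s K'] s by simp
  finally have "correlation K (\<phi> ` S) = correlation K' S" .
  moreover have "complex_of_real (measure M {\<omega> \<in> space M. \<forall>i\<in>\<phi> ` S. X i \<omega> = 1}) = correlation K (\<phi> ` S)"
    using D S \<phi> unfolding determinantal_process_iff by (meson finite_imageI image_mono subset_trans)
  ultimately show "complex_of_real (measure M {\<omega> \<in> space M. \<forall>i\<in>S. X (\<phi> i) \<omega> = 1}) = correlation K' S"
    by simp
qed

text \<open>The sigma-algebra of a bit is generated by the single event that it equals \<open>1\<close>, and a single
  event is a \<open>\<pi>\<close>-system.\<close>

lemma indep_var_bits:
  assumes "prob_space M" and X: "X \<in> measurable M bit_space" and Y: "Y \<in> measurable M bit_space"
    and eq: "measure M {\<omega> \<in> space M. X \<omega> = 1 \<and> Y \<omega> = 1} =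
      measure M {\<omega> \<in> space M. X \<omega> = 1} * measure M {\<omega> \<in> space M. Y \<omega> = 1}"
  shows "prob_space.indep_var M bit_space X bit_space Y"
proof -
  interpret prob_space M by fact
  define E where "E Z = {\<omega> \<in> space M. Z \<omega> = (1 :: nat)}" for Z
  have ev: "E Z \<in> events" if "Z \<in> measurable M bit_space" for Z
  proof -
    have "Z -` {1} \<inter> space M \<in> events" using that by (rule measurable_sets) simp
    also have "Z -` {1} \<inter> space M = E Z" by (auto simp: E_def)
    finally show ?thesis .
  qed
  have gen: "sigma_sets (space M) {Z -` A \<inter> space M | A. A \<in> sets bit_space} = sigma_sets (space M) {E Z}"
    if Z: "Z \<in> measurable M bit_space" for Z
  proof (rule sigma_sets_eqI)
    fix a assume "a \<in> {Z -` A \<inter> space M | A. A \<in> sets bit_space}"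
    then obtain A where A: "a = Z -` A \<inter> space M" "A \<subseteq> {0, 1}" by auto
    have bit: "Z \<omega> \<in> {0, 1}" if "\<omega> \<in> space M" for \<omega> using measurable_space[OF Z that] by simp
    have B: "E Z \<in> sigma_sets (space M) {E Z}" by (rule sigma_sets.Basic) simp
    have "A \<in> {{}, {0}, {1}, {0, 1}}" using A(2) by (simp add: Pow_insert flip: Pow_iff) blast
    then consider "A = {}" | "A = {0}" | "A = {1}" | "A = {0, 1}" by blast
    then show "a \<in> sigma_sets (space M) {E Z}"
    proof cases
      case 1 then show ?thesis using A(1) by (simp add: sigma_sets.Empty)
    next
      case 2
      then have "a = space M - E Z" using A(1) bit by (auto simp: E_def)
      then show ?thesis using B by (simp add: sigma_sets.Compl)
    next
      case 3
      then have "a = E Z" using A(1) by (auto simp: E_def)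
      then show ?thesis using B by simp
    next
      case 4
      then have "a = space M" using A(1) bit by auto
      then show ?thesis by (simp add: sigma_sets_top)
    qed
  next
    fix b assume "b \<in> {E Z}"
    then have "b = Z -` {1} \<inter> space M" by (auto simp: E_def)
    then show "b \<in> sigma_sets (space M) {Z -` A \<inter> space M | A. A \<in> sets bit_space}"
      by (intro sigma_sets.Basic) auto
  qed
  have "prob (E X \<inter> E Y) = prob (E X) * prob (E Y)"
  proof -
    have "E X \<inter> E Y = {\<omega> \<in> space M. X \<omega> = 1 \<and> Y \<omega> = 1}" by (auto simp: E_def)
    then show ?thesis using eq by (simp add: E_def)
  qed
  then have "indep_set {E X} {E Y}"
    using ev[OF X] ev[OF Y] by (intro indep_setI) auto
  then have "indep_set (sigma_sets (space M) {E X}) (sigma_sets (space M) {E Y})"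
    by (rule indep_set_sigma_sets) (auto intro: Int_stableI)
  then show ?thesis
    unfolding indep_var_eq gen[OF X] gen[OF Y] using X Y by simp
qed

lemma determinantal_process_indep:
  assumes D: "determinantal_process M I K X" and xy: "x \<in> I" "y \<in> I" "x \<noteq> y" and K: "K x y = 0"
  shows "prob_space.indep_var M bit_space (X x) bit_space (X y)"
proof (rule indep_var_bits)
  show "prob_space M" "X x \<in> measurable M bit_space" "X y \<in> measurable M bit_space"
    using D xy by (auto simp: determinantal_process_def bit_process_def)
  have c: "complex_of_real (measure M {\<omega> \<in> space M. \<forall>i\<in>S. X i \<omega> = 1}) = correlation K S"
    if "finite S" "S \<subseteq> I" for S using D that unfolding determinantal_process_iff by blast
  have e: "Determinant.det (kernel_mat L []) = 1" for L :: "'b \<Rightarrow> 'b \<Rightarrow> complex"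
    using det_dim_zero[of "kernel_mat L []"] by (simp add: kernel_mat_def)
  have one: "Determinant.det (kernel_mat L [z]) = L z z" for L and z :: 'b
    using det_kernel_mat_Cons[of L z "[]"] e by simp
  have two: "Determinant.det (kernel_mat K [x, y]) = K x x * K y y"
    using det_kernel_mat_Cons[of K x "[y]"] K one by (simp add: schur_complement_def)
  have "complex_of_real (measure M {\<omega> \<in> space M. X x \<omega> = 1 \<and> X y \<omega> = 1}) = K x x * K y y"
    using c[of "{x, y}"] correlation_set[of "[x, y]" K] xy two by simp
  also have "K x x = complex_of_real (measure M {\<omega> \<in> space M. X x \<omega> = 1})"
    using c[of "{x}"] correlation_set[of "[x]" K] xy one by simp
  also have "K y y = complex_of_real (measure M {\<omega> \<in> space M. X y \<omega> = 1})"
    using c[of "{y}"] correlation_set[of "[y]" K] xy one by simp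
  finally show "measure M {\<omega> \<in> space M. X x \<omega> = 1 \<and> X y \<omega> = 1} =
      measure M {\<omega> \<in> space M. X x \<omega> = 1} * measure M {\<omega> \<in> space M. X y \<omega> = 1}"
    by (simp only: of_real_eq_iff flip: of_real_mult)
qed

section \<open>Distances, rays and automorphisms of the tree\<close>

lemma tree_vertices_append [simp]:
  "\<sigma> @ \<rho> \<in> tree_vertices q \<longleftrightarrow> \<sigma> \<in> tree_vertices q \<and> \<rho> \<in> tree_vertices q"
  by (auto simp: tree_vertices_def)

lemma Nil_tree_vertices [simp]: "[] \<in> tree_vertices q"
  by (simp add: tree_vertices_def)

lemma tree_adj_sym: "tree_adj q \<sigma> \<tau> \<Longrightarrow> tree_adj q \<tau> \<sigma>"
  by (auto simp: tree_adj_def)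

lemma tree_walk_sym: "(tree_adj q ^^ n) \<sigma> \<tau> \<Longrightarrow> (tree_adj q ^^ n) \<tau> \<sigma>"
proof (induction n arbitrary: \<tau>)
  case (Suc n)
  then obtain \<rho> where "(tree_adj q ^^ n) \<sigma> \<rho>" "tree_adj q \<rho> \<tau>" by (elim relpowp_Suc_E)
  then show ?case using Suc.IH tree_adj_sym by (metis relpowp_Suc_I2)
qed simp

text \<open>Each step changes the level by one, which bounds distances from below; the direct walk between
  a vertex and a descendant attains the bound.\<close>

lemma tree_walk_length:
  "(tree_adj q ^^ n) \<sigma> \<tau> \<Longrightarrow> \<bar>int (length \<sigma>) - int (length \<tau>)\<bar> \<le> int n"
proof (induction n arbitrary: \<tau>)
  case (Suc n)
  then obtain \<rho> where *: "(tree_adj q ^^ n) \<sigma> \<rho>" "tree_adj q \<rho> \<tau>" by (elim relpowp_Suc_E)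
  have "\<bar>int (length \<rho>) - int (length \<tau>)\<bar> = 1" using *(2) by (auto simp: tree_adj_def)
  then show ?case using Suc.IH[OF *(1)] by simp
qed simp

lemma tree_walk_append:
  "\<sigma> @ \<rho> \<in> tree_vertices q \<Longrightarrow> (tree_adj q ^^ length \<rho>) \<sigma> (\<sigma> @ \<rho>)"
proof (induction \<rho> rule: rev_induct)
  case (snoc i \<rho>)
  then have "(tree_adj q ^^ length \<rho>) \<sigma> (\<sigma> @ \<rho>)" by simp
  moreover have "tree_adj q (\<sigma> @ \<rho>) (\<sigma> @ \<rho> @ [i])" using snoc.prems by (auto simp: tree_adj_def)
  ultimately show ?case by (auto intro: relpowp_Suc_I)
qed simp

lemma tree_dist_sym: "tree_dist q \<sigma> \<tau> = tree_dist q \<tau> \<sigma>"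
  unfolding tree_dist_def using tree_walk_sym by (metis (no_types))

lemma tree_dist_append:
  assumes "\<sigma> @ \<rho> \<in> tree_vertices q"
  shows "tree_dist q \<sigma> (\<sigma> @ \<rho>) = length \<rho>"
  unfolding tree_dist_def
  using tree_walk_append[OF assms] by (rule Least_equality) (use tree_walk_length in fastforce)

lemma tree_level_eq_length [simp]: "\<sigma> \<in> tree_vertices q \<Longrightarrow> tree_level q \<sigma> = length \<sigma>"
  unfolding tree_level_def using tree_dist_append[of "[]" \<sigma> q] by simp

lemma tree_dist_prefix:
  assumes "\<sigma> \<in> tree_vertices q" "\<tau> \<in> tree_vertices q" "prefix \<sigma> \<tau> \<or> prefix \<tau> \<sigma>"
  shows "int (tree_dist q \<sigma> \<tau>) = \<bar>int (length \<sigma>) - int (length \<tau>)\<bar>"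
proof -
  have *: "int (tree_dist q \<sigma> \<tau>) = \<bar>int (length \<sigma>) - int (length \<tau>)\<bar>"
    if "prefix \<sigma> \<tau>" "\<tau> \<in> tree_vertices q" for \<sigma> \<tau>
    using that tree_dist_append by (auto elim!: prefixE)
  show ?thesis using assms(3) *[of \<sigma> \<tau>] *[of \<tau> \<sigma>] assms(1,2) tree_dist_sym[of q \<sigma> \<tau>] by auto
qed

text \<open>A walk through the root. Without connectedness the least length in the definition of the
  distance would be meaningless.\<close>

lemma tree_walk_exists:
  assumes "\<sigma> \<in> tree_vertices q" "\<tau> \<in> tree_vertices q"
  shows "\<exists>n. (tree_adj q ^^ n) \<sigma> \<tau>"
  using tree_walk_append[of "[]" \<sigma> q] tree_walk_append[of "[]" \<tau> q] assms
    tree_walk_sym relpowp_trans by (metis append_Nil)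

lemma tree_walk_dist:
  assumes "\<sigma> \<in> tree_vertices q" "\<tau> \<in> tree_vertices q"
  shows "(tree_adj q ^^ tree_dist q \<sigma> \<tau>) \<sigma> \<tau>"
  unfolding tree_dist_def by (rule LeastI_ex[OF tree_walk_exists[OF assms]])

lemma ray_vertex: "rooted_geodesic_ray q \<xi> \<Longrightarrow> \<xi> n \<in> tree_vertices q"
  by (auto simp: rooted_geodesic_ray_def)

lemma ray_dist: "rooted_geodesic_ray q \<xi> \<Longrightarrow> int (tree_dist q (\<xi> m) (\<xi> n)) = \<bar>int m - int n\<bar>"
  by (simp add: rooted_geodesic_ray_def)

lemma ray_level: "rooted_geodesic_ray q \<xi> \<Longrightarrow> tree_level q (\<xi> n) = n"
  using ray_dist[of q \<xi> 0 n] by (simp add: tree_level_def rooted_geodesic_ray_def)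

lemma ray_length: "rooted_geodesic_ray q \<xi> \<Longrightarrow> length (\<xi> n) = n"
  using ray_level ray_vertex tree_level_eq_length by metis

lemma ray_step: "rooted_geodesic_ray q \<xi> \<Longrightarrow> \<exists>i. \<xi> (Suc n) = \<xi> n @ [i]"
proof -
  assume r: "rooted_geodesic_ray q \<xi>"
  have "tree_dist q (\<xi> n) (\<xi> (Suc n)) = 1" using ray_dist[OF r, of n "Suc n"] by simp
  then have "tree_adj q (\<xi> n) (\<xi> (Suc n))"
    using tree_walk_dist[OF ray_vertex[OF r] ray_vertex[OF r], of n "Suc n"] by (simp add: eq_OO)
  then show ?thesis using ray_length[OF r, of n] ray_length[OF r, of "Suc n"]
    by (auto simp: tree_adj_def)
qed

lemma ray_prefix:
  assumes "rooted_geodesic_ray q \<xi>" "m \<le> n"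
  shows "prefix (\<xi> m) (\<xi> n)"
  using assms(2)
proof (induction n rule: dec_induct)
  case (step n)
  then show ?case using ray_step[OF assms(1), of n] by (auto simp: prefix_def)
qed simp

text \<open>A ray adds one letter per step, so its vertices are nested prefixes. Conversely a pair of nested
  words lies on the ray that follows the longer word and then takes child \<open>0\<close> forever, which is
  where a child must exist.\<close>

lemma comparable_prefix:
  assumes "0 < q" "\<sigma> \<in> tree_vertices q" "\<tau> \<in> tree_vertices q"
  shows "comparable q \<sigma> \<tau> \<longleftrightarrow> prefix \<sigma> \<tau> \<or> prefix \<tau> \<sigma>"
proof
  assume "comparable q \<sigma> \<tau>"
  then obtain \<xi> m n where *: "rooted_geodesic_ray q \<xi>" "\<sigma> = \<xi> m" "\<tau> = \<xi> n"
    by (auto simp: comparable_def)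
  then show "prefix \<sigma> \<tau> \<or> prefix \<tau> \<sigma>" using ray_prefix[OF *(1)] nat_le_linear by blast
next
  have *: "\<exists>\<xi>. rooted_geodesic_ray q \<xi> \<and> \<sigma> \<in> range \<xi> \<and> \<tau> \<in> range \<xi>"
    if "prefix \<sigma> \<tau>" "\<tau> \<in> tree_vertices q" for \<sigma> \<tau>
  proof -
    \<comment> \<open>Appending as many zeros as the prefix is long makes the truncation never run out of letters.\<close>
    define \<xi> where "\<xi> n = take n (\<tau> @ replicate n 0)" for n
    have len: "length (\<xi> n) = n" for n by (simp add: \<xi>_def)
    have vert: "\<xi> n \<in> tree_vertices q" for n
      using that(2) assms(1) set_take_subset[of n "\<tau> @ replicate n 0"] unfolding \<xi>_def tree_vertices_def
      by (force dest: in_set_takeD)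
    have pre: "prefix (\<xi> m) (\<xi> n)" if "m \<le> n" for m n
    proof -
      have "\<xi> m = take m (\<xi> n)"
        using that by (simp add: \<xi>_def min_def)
      then show ?thesis by (simp add: take_is_prefix)
    qed
    have "rooted_geodesic_ray q \<xi>"
      unfolding rooted_geodesic_ray_def
    proof (intro conjI allI)
      show "\<xi> 0 = []" using len[of 0] by simp
      show "range \<xi> \<subseteq> tree_vertices q" using vert by auto
      show "int (tree_dist q (\<xi> m) (\<xi> n)) = \<bar>int m - int n\<bar>" for m n
        using tree_dist_prefix[OF vert vert, of m n] pre[of m n] pre[of n m] len nat_le_linear[of m n] by auto
    qed
    moreover have "\<sigma> = \<xi> (length \<sigma>)" using that(1) by (auto simp: \<xi>_def elim!: prefixE)
    moreover have "\<tau> = \<xi> (length \<tau>)" by (simp add: \<xi>_def)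
    ultimately show ?thesis by blast
  qed
  assume "prefix \<sigma> \<tau> \<or> prefix \<tau> \<sigma>"
  then show "comparable q \<sigma> \<tau>" unfolding comparable_def using *[of \<sigma> \<tau>] *[of \<tau> \<sigma>] assms by blast
qed

text \<open>An automorphism is only prescribed on vertices, so its inverse is taken on the vertex set. It
  turns preservation of walks and of comparability into equivalences.\<close>

lemma automorphism_inv:
  assumes "tree_automorphism q \<gamma>"
  shows "tree_automorphism q (inv_into (tree_vertices q) \<gamma>)"
proof -
  let ?V = "tree_vertices q" and ?g = "inv_into (tree_vertices q) \<gamma>"
  have b: "bij_betw \<gamma> ?V ?V" and n: "\<gamma> [] = []"
    and a: "\<And>\<sigma> \<tau>. \<sigma> \<in> ?V \<Longrightarrow> \<tau> \<in> ?V \<Longrightarrow> tree_adj q (\<gamma> \<sigma>) (\<gamma> \<tau>) \<longleftrightarrow> tree_adj q \<sigma> \<tau>"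
    using assms by (auto simp: tree_automorphism_def)
  have b': "bij_betw ?g ?V ?V" by (rule bij_betw_inv_into[OF b])
  have r: "\<gamma> (?g \<sigma>) = \<sigma>" if "\<sigma> \<in> ?V" for \<sigma> using that b by (simp add: bij_betw_inv_into_right)
  have m: "?g \<sigma> \<in> ?V" if "\<sigma> \<in> ?V" for \<sigma> using b' that bij_betwE by blast
  have "?g [] = []" using n bij_betw_inv_into_left[OF b, of "[]"] by simp
  moreover have "tree_adj q (?g \<sigma>) (?g \<tau>) \<longleftrightarrow> tree_adj q \<sigma> \<tau>" if "\<sigma> \<in> ?V" "\<tau> \<in> ?V" for \<sigma> \<tau>
    using a[OF m m, OF that] r that by simp
  ultimately show ?thesis unfolding tree_automorphism_def using b' by blast
qed

lemma automorphism_walk: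
  assumes "tree_automorphism q \<gamma>"
  shows "(tree_adj q ^^ n) \<sigma> \<tau> \<Longrightarrow> (tree_adj q ^^ n) (\<gamma> \<sigma>) (\<gamma> \<tau>)"
proof (induction n arbitrary: \<tau>)
  case (Suc n)
  then obtain \<rho> where *: "(tree_adj q ^^ n) \<sigma> \<rho>" "tree_adj q \<rho> \<tau>" by (elim relpowp_Suc_E)
  then have "tree_adj q (\<gamma> \<rho>) (\<gamma> \<tau>)"
    using assms unfolding tree_automorphism_def by (auto simp: tree_adj_def)
  then show ?case using Suc.IH[OF *(1)] by (rule relpowp_Suc_I[rotated])
qed simp

lemma automorphism_dist:
  assumes "tree_automorphism q \<gamma>" "\<sigma> \<in> tree_vertices q" "\<tau> \<in> tree_vertices q"
  shows "tree_dist q (\<gamma> \<sigma>) (\<gamma> \<tau>) = tree_dist q \<sigma> \<tau>"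
proof -
  have b: "bij_betw \<gamma> (tree_vertices q) (tree_vertices q)" using assms by (simp add: tree_automorphism_def)
  have "(tree_adj q ^^ n) (\<gamma> \<sigma>) (\<gamma> \<tau>) \<longleftrightarrow> (tree_adj q ^^ n) \<sigma> \<tau>" for n
    using automorphism_walk[OF assms(1), of n \<sigma> \<tau>]
      automorphism_walk[OF automorphism_inv[OF assms(1)], of n "\<gamma> \<sigma>" "\<gamma> \<tau>"]
      bij_betw_inv_into_left[OF b] assms by auto
  then show ?thesis by (simp add: tree_dist_def)
qed

lemma automorphism_vertex: "tree_automorphism q \<gamma> \<Longrightarrow> \<sigma> \<in> tree_vertices q \<Longrightarrow> \<gamma> \<sigma> \<in> tree_vertices q"
  unfolding tree_automorphism_def using bij_betwE by blast

lemma automorphism_comparable_imp: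
  assumes \<gamma>: "tree_automorphism q \<gamma>" and "comparable q \<sigma> \<tau>"
  shows "comparable q (\<gamma> \<sigma>) (\<gamma> \<tau>)"
proof -
  obtain \<xi> where \<xi>: "rooted_geodesic_ray q \<xi>" "\<sigma> \<in> range \<xi>" "\<tau> \<in> range \<xi>"
    using assms(2) by (auto simp: comparable_def)
  have "rooted_geodesic_ray q (\<gamma> \<circ> \<xi>)"
    unfolding rooted_geodesic_ray_def
  proof (intro conjI allI)
    show "(\<gamma> \<circ> \<xi>) 0 = []" using \<gamma> \<xi>(1) by (simp add: rooted_geodesic_ray_def tree_automorphism_def)
    show "range (\<gamma> \<circ> \<xi>) \<subseteq> tree_vertices q"
      using ray_vertex[OF \<xi>(1)] automorphism_vertex[OF \<gamma>] by auto
    show "int (tree_dist q ((\<gamma> \<circ> \<xi>) m) ((\<gamma> \<circ> \<xi>) n)) = \<bar>int m - int n\<bar>" for m n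
      using ray_dist[OF \<xi>(1)] by (simp add: automorphism_dist[OF \<gamma>] ray_vertex[OF \<xi>(1)])
  qed
  then show ?thesis unfolding comparable_def using \<xi>(2,3) by (intro exI[of _ "\<gamma> \<circ> \<xi>"]) auto
qed

lemma automorphism_comparable:
  assumes "tree_automorphism q \<gamma>" "\<sigma> \<in> tree_vertices q" "\<tau> \<in> tree_vertices q"
  shows "comparable q (\<gamma> \<sigma>) (\<gamma> \<tau>) \<longleftrightarrow> comparable q \<sigma> \<tau>"
proof -
  have b: "bij_betw \<gamma> (tree_vertices q) (tree_vertices q)" using assms by (simp add: tree_automorphism_def)
  show ?thesis
    using automorphism_comparable_imp[OF assms(1), of \<sigma> \<tau>]
      automorphism_comparable_imp[OF automorphism_inv[OF assms(1)], of "\<gamma> \<sigma>" "\<gamma> \<tau>"]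
      bij_betw_inv_into_left[OF b] assms by auto
qed

section \<open>Stationarity and symmetries of determinantal processes on the tree\<close>

lemma branching_toeplitz_automorphism:
  assumes "tree_automorphism q \<gamma>" "\<sigma> \<in> tree_vertices q" "\<tau> \<in> tree_vertices q"
  shows "branching_toeplitz q f (\<gamma> \<sigma>) (\<gamma> \<tau>) = branching_toeplitz q f \<sigma> \<tau>"
proof -
  have "tree_level q (\<gamma> \<sigma>) = tree_level q \<sigma>" if "\<sigma> \<in> tree_vertices q" for \<sigma>
    using automorphism_dist[OF assms(1), of "[]" \<sigma>] that assms(1)
    by (simp add: tree_level_def tree_automorphism_def del: tree_level_eq_length)
  then show ?thesis
    using assms by (simp add: branching_toeplitz_def automorphism_dist automorphism_comparable del: tree_level_eq_length)
qed

text \<open>Along a ray only the difference of the levels enters, which is why the process there is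
  stationary and why all rays look alike.\<close>

lemma branching_toeplitz_ray:
  assumes \<xi>: "rooted_geodesic_ray q \<xi>"
  shows "branching_toeplitz q f (\<xi> m) (\<xi> n) =
    of_real (real q powr (- \<bar>real m - real n\<bar> / 2)) * fourier_coeff f (int m - int n)"
proof -
  have "real (tree_dist q (\<xi> m) (\<xi> n)) = of_int (int (tree_dist q (\<xi> m) (\<xi> n)))" by simp
  also have "\<dots> = \<bar>real m - real n\<bar>" unfolding ray_dist[OF \<xi>] by simp
  finally have d: "real (tree_dist q (\<xi> m) (\<xi> n)) = \<bar>real m - real n\<bar>" .
  have "comparable q (\<xi> m) (\<xi> n)" unfolding comparable_def using \<xi> by blast
  then show ?thesis by (simp add: branching_toeplitz_def d ray_level[OF \<xi>])
qed

theorem determinantal_branching_SSSP: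
  assumes q: "0 < q"
    and D: "determinantal_process M (tree_vertices q) (branching_toeplitz q f) X"
  shows "branching_SSSP q M X"
proof -
  define T where "T m n = of_real (real q powr (- \<bar>real m - real n\<bar> / 2)) * fourier_coeff f (int m - int n)" for m n
  have ray: "determinantal_process M UNIV T (\<lambda>n. X (\<xi> n))" if \<xi>: "rooted_geodesic_ray q \<xi>" for \<xi>
  proof (rule determinantal_process_reindex[OF D])
    show "inj \<xi>" by (metis injI ray_length[OF \<xi>])
    show "range \<xi> \<subseteq> tree_vertices q" using ray_vertex[OF \<xi>] by auto
  qed (simp add: branching_toeplitz_ray[OF \<xi>] T_def)
  have shift: "determinantal_process M UNIV T (\<lambda>n. X (\<xi> (n + k)))" if "rooted_geodesic_ray q \<xi>" for \<xi> k
    by (rule determinantal_process_reindex[OF ray[OF that], where \<phi> = "\<lambda>n. n + k"]) (auto simp: T_def)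
  have indep: "prob_space.indep_var M bit_space (X \<sigma>) bit_space (X \<tau>)"
    if "\<sigma> \<in> tree_vertices q" "\<tau> \<in> tree_vertices q" "\<not> comparable q \<sigma> \<tau>" for \<sigma> \<tau>
  proof (rule determinantal_process_indep[OF D that(1,2)])
    show "branching_toeplitz q f \<sigma> \<tau> = 0" using that(3) by (simp add: branching_toeplitz_def)
    show "\<sigma> \<noteq> \<tau>" using that comparable_prefix[OF q that(1,2)] by auto
  qed
  show ?thesis
    unfolding branching_SSSP_def strictly_stationary_def
  proof (intro conjI allI ballI impI)
    show "bit_process M (tree_vertices q) X" using D by (simp add: determinantal_process_def)
    show "process_law M UNIV (\<lambda>n. X (\<xi> (n + k))) = process_law M UNIV (\<lambda>n. X (\<xi> n))"
      if "rooted_geodesic_ray q \<xi>" for \<xi> k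
      by (rule determinantal_process_law_eq[OF shift[OF that] ray[OF that]])
    show "process_law M UNIV (\<lambda>n. X (\<xi> n)) = process_law M UNIV (\<lambda>n. X (\<xi>' n))"
      if "rooted_geodesic_ray q \<xi> \<and> rooted_geodesic_ray q \<xi>'" for \<xi> \<xi>'
      using that by (intro determinantal_process_law_eq[OF ray ray]) auto
  qed (rule indep)
qed

theorem determinantal_automorphism_invariant:
  assumes D: "determinantal_process M (tree_vertices q) (branching_toeplitz q f) X"
  shows "automorphism_invariant q M X"
  unfolding automorphism_invariant_def
proof (intro allI impI)
  fix \<gamma> assume \<gamma>: "tree_automorphism q \<gamma>"
  have b: "bij_betw \<gamma> (tree_vertices q) (tree_vertices q)" using \<gamma> by (simp add: tree_automorphism_def)
  have "determinantal_process M (tree_vertices q) (branching_toeplitz q f) (\<lambda>\<sigma>. X (\<gamma> \<sigma>))"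
    using b by (intro determinantal_process_reindex[OF D] branching_toeplitz_automorphism[OF \<gamma>])
      (auto simp: bij_betw_def)
  then show "process_law M (tree_vertices q) (\<lambda>\<sigma>. X (\<gamma> \<sigma>)) = process_law M (tree_vertices q) X"
    using D by (rule determinantal_process_law_eq)
qed

section \<open>Fourier coefficients of a weight on the circle\<close>

text \<open>The class is stable under \<open>f \<mapsto> 1 - f\<close>, which exchanges the kernel of \<open>f\<close> with its hole kernel.\<close>

definition circle_weight :: "(complex \<Rightarrow> real) \<Rightarrow> bool" where
  "circle_weight f \<longleftrightarrow> (\<lambda>\<theta>. f (cis \<theta>)) \<in> borel_measurable lebesgue \<and> (\<forall>\<theta>. f (cis \<theta>) \<in> {0..1})"

lemma circle_weight_one_minus: "circle_weight f \<Longrightarrow> circle_weight (\<lambda>z. 1 - f z)"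
  unfolding circle_weight_def by auto

lemma circle_weight_const: "circle_weight (\<lambda>_. 1)"
  unfolding circle_weight_def by auto

lemma cis_measurable_lebesgue: "(\<lambda>\<theta>. cis (c * \<theta>)) \<in> borel_measurable lebesgue"
proof (rule measurable_completion)
  have "continuous_on UNIV (\<lambda>\<theta>. cis (c * \<theta>))" by (intro continuous_intros)
  then show "(\<lambda>\<theta>. cis (c * \<theta>)) \<in> borel_measurable lborel" by (simp add: borel_measurable_continuous_onI)
qed

lemma fourier_integrable:
  assumes "circle_weight f"
  shows "integrable lebesgue (\<lambda>\<theta>. indicator {0..2*pi} \<theta> *\<^sub>R (complex_of_real (f (cis \<theta>)) * cis (- (of_int n * \<theta>))))"
proof (rule integrableI_bounded_set_indicator[where B = 1])
  have "(\<lambda>\<theta>. cis (- (of_int n * \<theta>))) \<in> borel_measurable lebesgue"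
    using cis_measurable_lebesgue[of "- of_int n"] by simp
  then show "(\<lambda>\<theta>. complex_of_real (f (cis \<theta>)) * cis (- (of_int n * \<theta>))) \<in> borel_measurable lebesgue"
    using assms unfolding circle_weight_def by (intro borel_measurable_times borel_measurable_of_real) auto
  show "AE \<theta> in lebesgue. \<theta> \<in> {0..2*pi} \<longrightarrow> norm (complex_of_real (f (cis \<theta>)) * cis (- (of_int n * \<theta>))) \<le> 1"
    using assms by (auto simp: circle_weight_def norm_mult abs_le_iff intro!: AE_I2 order_trans[of _ 0])
qed auto

lemma fourier_coeff_minus: "fourier_coeff f (- n) = cnj (fourier_coeff f n)"
proof -
  have "(LINT \<theta>:{0..2*pi}|lebesgue. complex_of_real (f (cis \<theta>)) * cis (- (of_int (- n) * \<theta>))) =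
    (LINT \<theta>|lebesgue. cnj (indicator {0..2*pi} \<theta> *\<^sub>R (complex_of_real (f (cis \<theta>)) * cis (- (of_int n * \<theta>)))))"
    unfolding set_lebesgue_integral_def by (intro Bochner_Integration.integral_cong) (simp_all add: cis_cnj)
  also have "\<dots> = cnj (LINT \<theta>:{0..2*pi}|lebesgue. complex_of_real (f (cis \<theta>)) * cis (- (of_int n * \<theta>)))"
    unfolding set_lebesgue_integral_def by (rule Bochner_Integration.integral_cnj)
  finally show ?thesis by (simp add: fourier_coeff_def)
qed

lemma cis_integral:
  assumes "n \<noteq> 0"
  shows "((\<lambda>\<theta>. cis (- (of_int n * \<theta>))) has_integral 0) {0..2*pi}"
proof -
  \<comment> \<open>A primitive of the character; being periodic, it has equal boundary values.\<close>
  define P where "P \<theta> = cis (- (of_int n * \<theta>)) * (\<i> / of_int n)" for \<theta>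
  have "((\<lambda>\<theta>. cis (- (of_int n * \<theta>))) has_integral (P (2*pi) - P 0)) {0..2*pi}"
  proof (rule fundamental_theorem_of_calculus)
    fix \<theta> :: real
    have e: "P = (\<lambda>\<theta>. exp (- (of_int n * \<i>) * of_real \<theta>) * (\<i> / of_int n))"
      by (auto simp: P_def cis_conv_exp fun_eq_iff mult_ac)
    have "((\<lambda>x. exp (- (of_int n * \<i>) * x) * (\<i> / of_int n)) has_field_derivative
        exp (- (of_int n * \<i>) * of_real \<theta>)) (at (of_real \<theta>))"
      using assms by (auto intro!: derivative_eq_intros)
    then have "((\<lambda>x. exp (- (of_int n * \<i>) * of_real x) * (\<i> / of_int n)) has_vector_derivative
        exp (- (of_int n * \<i>) * of_real \<theta>)) (at \<theta> within {0..2*pi})"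
      by (rule has_vector_derivative_real_field)
    also have "exp (- (of_int n * \<i>) * of_real \<theta>) = cis (- (of_int n * \<theta>))"
      by (simp add: cis_conv_exp mult_ac)
    finally show "(P has_vector_derivative cis (- (of_int n * \<theta>))) (at \<theta> within {0..2*pi})"
      unfolding e .
  qed auto
  moreover have "P (2*pi) = P 0"
  proof -
    have "cis (- (of_int n * (2*pi))) = cis (2 * pi * of_int (- n))" by (simp add: mult_ac)
    also have "\<dots> = 1" by (rule cis_multiple_2pi) simp
    finally show ?thesis by (simp add: P_def)
  qed
  ultimately show ?thesis by simp
qed

lemma fourier_coeff_one: "fourier_coeff (\<lambda>_. 1) n = of_bool (n = 0)"
proof (cases "n = 0")
  case True
  have "(LINT \<theta>:{0..2*pi}|lebesgue. (1 :: complex)) = of_real (2*pi)"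
    by (subst set_integral_const) (auto simp: scaleR_conv_of_real)
  then show ?thesis using True by (simp add: fourier_coeff_def)
next
  case False
  have "set_integrable lebesgue {0..2*pi} (\<lambda>\<theta>. cis (- (of_int n * \<theta>)))"
    using fourier_integrable[OF circle_weight_const, of n] by (simp add: set_integrable_def)
  then have "(LINT \<theta>:{0..2*pi}|lebesgue. cis (- (of_int n * \<theta>))) = integral {0..2*pi} (\<lambda>\<theta>. cis (- (of_int n * \<theta>)))"
    by (rule set_lebesgue_integral_eq_integral)
  also have "\<dots> = 0" using cis_integral[OF False] by (rule integral_unique)
  finally show ?thesis using False by (simp add: fourier_coeff_def)
qed

lemma fourier_coeff_one_minus:
  assumes "circle_weight f"
  shows "fourier_coeff (\<lambda>z. 1 - f z) n = of_bool (n = 0) - fourier_coeff f n"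
proof -
  let ?g = "\<lambda>f \<theta>. indicator {0..2*pi} \<theta> *\<^sub>R (complex_of_real (f (cis \<theta>)) * cis (- (of_int n * \<theta>)))"
  have "(LINT \<theta>|lebesgue. ?g (\<lambda>z. 1 - f z) \<theta>) = (LINT \<theta>|lebesgue. ?g (\<lambda>_. 1) \<theta> - ?g f \<theta>)"
    by (intro Bochner_Integration.integral_cong) (simp_all add: algebra_simps)
  also have "\<dots> = (LINT \<theta>|lebesgue. ?g (\<lambda>_. 1) \<theta>) - (LINT \<theta>|lebesgue. ?g f \<theta>)"
    by (rule Bochner_Integration.integral_diff[OF fourier_integrable[OF circle_weight_const] fourier_integrable[OF assms]])
  finally have "fourier_coeff (\<lambda>z. 1 - f z) n = fourier_coeff (\<lambda>_. 1) n - fourier_coeff f n"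
    by (simp add: fourier_coeff_def set_lebesgue_integral_def diff_divide_distrib)
  then show ?thesis by (simp add: fourier_coeff_one)
qed

text \<open>The form is the integral of the nonnegative function \<open>f(cis \<theta>) \<cdot> |p(\<theta>)|\<^sup>2\<close> for the trigonometric
  polynomial \<open>p\<close> with coefficients \<open>a\<close>. The frequencies \<open>l\<close> may repeat, as they do for several
  vertices at one level.\<close>

lemma toeplitz_form_nonneg:
  fixes l :: "'a \<Rightarrow> int" and a :: "'a \<Rightarrow> complex"
  assumes f: "circle_weight f"
  shows "0 \<le> Re (\<Sum>x\<in>F. \<Sum>y\<in>F. fourier_coeff f (l x - l y) * a y * cnj (a x))"
proof -
  define g where "g n \<theta> = indicator {0..2*pi} \<theta> *\<^sub>R (complex_of_real (f (cis \<theta>)) * cis (- (of_int n * \<theta>)))"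
    for n and \<theta> :: real
  have g: "integrable lebesgue (g n)" for n unfolding g_def by (rule fourier_integrable[OF f])
  have fc: "fourier_coeff f n = (LINT \<theta>|lebesgue. g n \<theta>) / of_real (2*pi)" for n
    by (simp add: fourier_coeff_def set_lebesgue_integral_def g_def)
  define p where "p \<theta> = (\<Sum>y\<in>F. a y * cis (of_int (l y) * \<theta>))" for \<theta>
  have pt: "(\<Sum>x\<in>F. \<Sum>y\<in>F. g (l x - l y) \<theta> * (a y * cnj (a x))) =
      of_real (indicator {0..2*pi} \<theta> * f (cis \<theta>) * (norm (p \<theta>))\<^sup>2)" for \<theta>
  proof -
    have "g (l x - l y) \<theta> * (a y * cnj (a x)) =
      of_real (indicator {0..2*pi} \<theta> * f (cis \<theta>)) * (cnj (a x * cis (of_int (l x) * \<theta>)) * (a y * cis (of_int (l y) * \<theta>)))" for x y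
    proof -
      have "cis (- (of_int (l x - l y) * \<theta>)) = cnj (cis (of_int (l x) * \<theta>)) * cis (of_int (l y) * \<theta>)"
        by (simp add: cis_cnj cis_mult algebra_simps)
      then show ?thesis by (simp add: g_def scaleR_conv_of_real mult_ac)
    qed
    then have "(\<Sum>x\<in>F. \<Sum>y\<in>F. g (l x - l y) \<theta> * (a y * cnj (a x))) =
      of_real (indicator {0..2*pi} \<theta> * f (cis \<theta>)) * (cnj (p \<theta>) * p \<theta>)"
      unfolding p_def cnj_sum sum_product by (simp only: sum_distrib_left)
    also have "cnj (p \<theta>) * p \<theta> = of_real ((norm (p \<theta>))\<^sup>2)"
      unfolding complex_norm_square by (rule mult.commute)
    finally show ?thesis by simp
  qed
  have "(\<Sum>x\<in>F. \<Sum>y\<in>F. fourier_coeff f (l x - l y) * a y * cnj (a x)) =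
    (\<Sum>x\<in>F. \<Sum>y\<in>F. LINT \<theta>|lebesgue. g (l x - l y) \<theta> * (a y * cnj (a x))) / of_real (2*pi)"
    unfolding sum_divide_distrib fc by (simp add: g mult_ac)
  also have "(\<Sum>x\<in>F. \<Sum>y\<in>F. LINT \<theta>|lebesgue. g (l x - l y) \<theta> * (a y * cnj (a x))) =
    (LINT \<theta>|lebesgue. (\<Sum>x\<in>F. \<Sum>y\<in>F. g (l x - l y) \<theta> * (a y * cnj (a x))))"
    using g by (simp add: Bochner_Integration.integral_sum)
  also have "\<dots> = of_real (LINT \<theta>|lebesgue. indicator {0..2*pi} \<theta> * f (cis \<theta>) * (norm (p \<theta>))\<^sup>2)"
    unfolding pt by (rule Bochner_Integration.integral_complex_of_real)
  finally have "(\<Sum>x\<in>F. \<Sum>y\<in>F. fourier_coeff f (l x - l y) * a y * cnj (a x)) =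
    of_real ((LINT \<theta>|lebesgue. indicator {0..2*pi} \<theta> * f (cis \<theta>) * (norm (p \<theta>))\<^sup>2) / (2*pi))"
    by simp
  moreover have "0 \<le> (LINT \<theta>|lebesgue. indicator {0..2*pi} \<theta> * f (cis \<theta>) * (norm (p \<theta>))\<^sup>2)"
    using f by (intro Bochner_Integration.integral_nonneg) (auto simp: circle_weight_def)
  ultimately show ?thesis by (simp del: of_real_divide)
qed

section \<open>Positivity of the branching-Toeplitz kernel\<close>

lemma branching_toeplitz_eq:
  assumes "0 < q" "\<sigma> \<in> tree_vertices q" "\<tau> \<in> tree_vertices q"
  shows "branching_toeplitz q f \<sigma> \<tau> = of_real (if prefix \<sigma> \<tau> \<or> prefix \<tau> \<sigma>
      then real q powr (- \<bar>real (length \<sigma>) - real (length \<tau>)\<bar> / 2) else 0) *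
    fourier_coeff f (int (length \<sigma>) - int (length \<tau>))"
proof (cases "prefix \<sigma> \<tau> \<or> prefix \<tau> \<sigma>")
  case True
  have "real (tree_dist q \<sigma> \<tau>) = of_int (int (tree_dist q \<sigma> \<tau>))" by simp
  also have "\<dots> = \<bar>real (length \<sigma>) - real (length \<tau>)\<bar>" unfolding tree_dist_prefix[OF assms(2,3) True] by simp
  finally have "real (tree_dist q \<sigma> \<tau>) = \<bar>real (length \<sigma>) - real (length \<tau>)\<bar>" .
  then show ?thesis using assms True comparable_prefix[OF assms] by (simp add: branching_toeplitz_def)
next
  case False
  then show ?thesis using comparable_prefix[OF assms] by (simp add: branching_toeplitz_def)
qed

definition tree_sphere :: "nat \<Rightarrow> nat \<Rightarrow> nat list set" where
  "tree_sphere q N = {w \<in> tree_vertices q. length w = N}"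

lemma finite_tree_sphere [simp]: "finite (tree_sphere q N)"
  unfolding tree_sphere_def tree_vertices_def
  using finite_lists_length_eq[of "{..<q}" N] by (simp add: Collect_conj_eq)

lemma card_descendants:
  assumes "\<tau> \<in> tree_vertices q" "length \<tau> \<le> N"
  shows "card {w \<in> tree_sphere q N. prefix \<tau> w} = q ^ (N - length \<tau>)"
proof -
  have "{w \<in> tree_sphere q N. prefix \<tau> w} = (\<lambda>\<rho>. \<tau> @ \<rho>) ` {\<rho>. set \<rho> \<subseteq> {..<q} \<and> length \<rho> = N - length \<tau>}"
    using assms by (auto simp: tree_sphere_def tree_vertices_def prefix_def)
  then show ?thesis
    by (simp add: card_image inj_on_def card_lists_length_eq)
qed

text \<open>The combinatorial core: the geometric decay of the kernel and its vanishing off comparable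
  pairs are both effects of counting the common descendants on a sphere.\<close>

lemma common_descendants:
  assumes q: "0 < q" and \<sigma>: "\<sigma> \<in> tree_vertices q" "length \<sigma> \<le> N" and \<tau>: "\<tau> \<in> tree_vertices q" "length \<tau> \<le> N"
  shows "real q powr ((real (length \<sigma>) + real (length \<tau>)) / 2) *
      real (card {w \<in> tree_sphere q N. prefix \<sigma> w \<and> prefix \<tau> w}) =
    real q ^ N * (if prefix \<sigma> \<tau> \<or> prefix \<tau> \<sigma>
      then real q powr (- \<bar>real (length \<sigma>) - real (length \<tau>)\<bar> / 2) else 0)"
proof -
  \<comment> \<open>The descendants of the lower vertex are the common ones.\<close>
  have nested: "real q powr ((real (length \<sigma>) + real (length \<tau>)) / 2) *
      real (card {w \<in> tree_sphere q N. prefix \<sigma> w \<and> prefix \<tau> w}) =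
      real q ^ N * real q powr (- \<bar>real (length \<sigma>) - real (length \<tau>)\<bar> / 2)"
    if "prefix \<sigma> \<tau>" "\<tau> \<in> tree_vertices q" "length \<tau> \<le> N" for \<sigma> \<tau>
  proof -
    have le: "length \<sigma> \<le> length \<tau>" using that(1) by (rule prefix_length_le)
    have "{w \<in> tree_sphere q N. prefix \<sigma> w \<and> prefix \<tau> w} = {w \<in> tree_sphere q N. prefix \<tau> w}"
      using that(1) by (auto intro: prefix_order.trans)
    then have "real (card {w \<in> tree_sphere q N. prefix \<sigma> w \<and> prefix \<tau> w}) = real q powr (real N - real (length \<tau>))"
      using card_descendants[OF that(2,3)] q that(3) by (simp add: powr_realpow of_nat_diff flip: of_nat_diff)
    moreover have "real q ^ N = real q powr real N" using q by (simp add: powr_realpow)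
    ultimately show ?thesis using le by (simp add: field_simps flip: powr_add)
  qed
  consider "prefix \<sigma> \<tau>" | "prefix \<tau> \<sigma>" | "\<not> prefix \<sigma> \<tau>" "\<not> prefix \<tau> \<sigma>" by blast
  then show ?thesis
  proof cases
    case 1 then show ?thesis using nested[OF 1 \<tau>] by simp
  next
    case 2
    have "{w \<in> tree_sphere q N. prefix \<sigma> w \<and> prefix \<tau> w} = {w \<in> tree_sphere q N. prefix \<tau> w \<and> prefix \<sigma> w}" by auto
    then show ?thesis using nested[OF 2 \<sigma>] 2 by (simp add: add.commute abs_minus_commute)
  next
    case 3
    then have e: "{w \<in> tree_sphere q N. prefix \<sigma> w \<and> prefix \<tau> w} = {}" using prefix_same_cases by blast
    show ?thesis unfolding e using 3 by simp
  qed
qed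

text \<open>Averaging over the words of length \<open>N\<close> writes the form on \<open>F\<close> as a mean of Toeplitz forms, one
  for each descending path, where only the vertices of \<open>F\<close> on that path contribute.\<close>

lemma psd_branching_toeplitz:
  assumes q: "0 < q" and f: "circle_weight f"
  shows "psd_kernel (tree_vertices q) (branching_toeplitz q f)"
  unfolding psd_kernel_def
proof (intro conjI ballI allI impI)
  let ?V = "tree_vertices q"
  show "branching_toeplitz q f \<tau> \<sigma> = cnj (branching_toeplitz q f \<sigma> \<tau>)" if "\<sigma> \<in> ?V" "\<tau> \<in> ?V" for \<sigma> \<tau>
    using fourier_coeff_minus[of f "int (length \<sigma>) - int (length \<tau>)"]
    unfolding branching_toeplitz_eq[OF q that] branching_toeplitz_eq[OF q that(2,1)]
    by (auto simp: abs_minus_commute)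
  fix F and u :: "nat list \<Rightarrow> complex"
  assume F: "finite F \<and> F \<subseteq> ?V"
  \<comment> \<open>A sphere beyond all vertices of \<open>F\<close>; the \<open>0\<close> covers the empty set.\<close>
  define N where "N = Max (insert 0 (length ` F))"
  have N: "length \<sigma> \<le> N" if "\<sigma> \<in> F" for \<sigma>
    unfolding N_def using F that by (intro Max_ge) auto
  define a where "a w \<sigma> = (if prefix \<sigma> w then of_real (real q powr (real (length \<sigma>) / 2)) * u \<sigma> else 0)" for w \<sigma>
  let ?c = "\<lambda>\<sigma> \<tau>. fourier_coeff f (int (length \<sigma>) - int (length \<tau>))"
  have ker: "of_real (real q ^ N) * (branching_toeplitz q f \<sigma> \<tau> * u \<tau> * cnj (u \<sigma>)) =
      (\<Sum>w\<in>tree_sphere q N. ?c \<sigma> \<tau> * a w \<tau> * cnj (a w \<sigma>))" if "\<sigma> \<in> F" "\<tau> \<in> F" for \<sigma> \<tau>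
  proof -
    have "(\<Sum>w\<in>tree_sphere q N. ?c \<sigma> \<tau> * a w \<tau> * cnj (a w \<sigma>)) =
      (\<Sum>w\<in>tree_sphere q N. if prefix \<sigma> w \<and> prefix \<tau> w then
        ?c \<sigma> \<tau> * of_real (real q powr ((real (length \<sigma>) + real (length \<tau>)) / 2)) * u \<tau> * cnj (u \<sigma>) else 0)"
      by (intro sum.cong refl) (auto simp: a_def add_divide_distrib powr_add)
    also have "\<dots> = of_real (real q powr ((real (length \<sigma>) + real (length \<tau>)) / 2) *
        real (card {w \<in> tree_sphere q N. prefix \<sigma> w \<and> prefix \<tau> w})) * (?c \<sigma> \<tau> * u \<tau> * cnj (u \<sigma>))"
      by (simp add: sum.inter_filter[symmetric])
    also have "\<dots> = of_real (real q ^ N) * (branching_toeplitz q f \<sigma> \<tau> * u \<tau> * cnj (u \<sigma>))"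
    proof -
      have v: "\<sigma> \<in> ?V" "\<tau> \<in> ?V" using F that by auto
      show ?thesis
        unfolding common_descendants[OF q v(1) N[OF that(1)] v(2) N[OF that(2)]]
          branching_toeplitz_eq[OF q v] by simp
    qed
    finally show ?thesis by simp
  qed
  have "of_real (real q ^ N) * quad_form F (branching_toeplitz q f) u =
      (\<Sum>\<sigma>\<in>F. \<Sum>\<tau>\<in>F. \<Sum>w\<in>tree_sphere q N. ?c \<sigma> \<tau> * a w \<tau> * cnj (a w \<sigma>))"
    unfolding quad_form_def sum_distrib_left by (intro sum.cong refl) (simp only: ker)
  also have "\<dots> = (\<Sum>\<sigma>\<in>F. \<Sum>w\<in>tree_sphere q N. \<Sum>\<tau>\<in>F. ?c \<sigma> \<tau> * a w \<tau> * cnj (a w \<sigma>))"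
    by (rule sum.cong[OF refl], rule sum.swap)
  also have "\<dots> = (\<Sum>w\<in>tree_sphere q N. \<Sum>\<sigma>\<in>F. \<Sum>\<tau>\<in>F. ?c \<sigma> \<tau> * a w \<tau> * cnj (a w \<sigma>))"
    by (rule sum.swap)
  finally have avg: "of_real (real q ^ N) * quad_form F (branching_toeplitz q f) u =
      (\<Sum>w\<in>tree_sphere q N. \<Sum>\<sigma>\<in>F. \<Sum>\<tau>\<in>F. ?c \<sigma> \<tau> * a w \<tau> * cnj (a w \<sigma>))" .
  have "real q ^ N * Re (quad_form F (branching_toeplitz q f) u) =
      Re (of_real (real q ^ N) * quad_form F (branching_toeplitz q f) u)"
    by (simp del: of_real_power of_real_of_nat_eq)
  also have "\<dots> = (\<Sum>w\<in>tree_sphere q N. Re (\<Sum>\<sigma>\<in>F. \<Sum>\<tau>\<in>F. ?c \<sigma> \<tau> * a w \<tau> * cnj (a w \<sigma>)))"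
    unfolding avg Re_sum ..
  also have "\<dots> \<ge> 0" by (intro sum_nonneg toeplitz_form_nonneg[OF f])
  finally show "0 \<le> Re (quad_form F (branching_toeplitz q f) u)"
    using q by (metis mult_le_0_iff zero_le_mult_iff of_nat_0_less_iff zero_less_power not_le)
qed

lemma psd_kernel_cong:
  assumes "\<And>x y. x \<in> I \<Longrightarrow> y \<in> I \<Longrightarrow> K x y = K' x y"
  shows "psd_kernel I K \<longleftrightarrow> psd_kernel I K'"
proof -
  have "quad_form F K u = quad_form F K' u" if "F \<subseteq> I" for F u
    unfolding quad_form_def using assms that by (intro sum.cong refl) auto
  then show ?thesis unfolding psd_kernel_def using assms by auto
qed

text \<open>Here the identity operator is recognised as the branching-Toeplitz kernel of the constant \<open>1\<close>.\<close>

theorem contraction_branching_toeplitz: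
  assumes q: "0 < q" and f: "circle_weight f"
  shows "contraction_kernel (tree_vertices q) (branching_toeplitz q f)"
proof -
  have "hole_kernel (branching_toeplitz q f) \<sigma> \<tau> = branching_toeplitz q (\<lambda>z. 1 - f z) \<sigma> \<tau>"
    if "\<sigma> \<in> tree_vertices q" "\<tau> \<in> tree_vertices q" for \<sigma> \<tau>
  proof (cases "length \<sigma> = length \<tau> \<and> (prefix \<sigma> \<tau> \<or> prefix \<tau> \<sigma>)")
    case True
    then have "\<sigma> = \<tau>" by (auto simp: prefix_def)
    then show ?thesis
      unfolding hole_kernel_def branching_toeplitz_eq[OF q that] fourier_coeff_one_minus[OF f]
      using q by simp
  next
    case False
    then show ?thesis
      unfolding hole_kernel_def branching_toeplitz_eq[OF q that] fourier_coeff_one_minus[OF f]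
      by (auto simp: algebra_simps)
  qed
  then show ?thesis
    unfolding contraction_kernel_def
    using psd_branching_toeplitz[OF q f] psd_branching_toeplitz[OF q circle_weight_one_minus[OF f]]
      psd_kernel_cong[of "tree_vertices q"] by metis
qed

section \<open>The operator of a contractive kernel\<close>

text \<open>Outside \<open>I\<close> the value is zero, since elements of \<open>ell2 I\<close> vanish there.\<close>

definition kernel_operator :: "'a set \<Rightarrow> ('a \<Rightarrow> 'a \<Rightarrow> complex) \<Rightarrow> ('a \<Rightarrow> complex) \<Rightarrow> 'a \<Rightarrow> complex" where
  "kernel_operator I K u = (\<lambda>i. if i \<in> I then infsum (\<lambda>j. K i j * u j) I else 0)"

lemma ell2_summable: "u \<in> ell2 I \<Longrightarrow> (\<lambda>i. (norm (u i))\<^sup>2) summable_on I"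
  by (simp add: ell2_def)

lemma ell2_outside: "u \<in> ell2 I \<Longrightarrow> i \<notin> I \<Longrightarrow> u i = 0"
  by (simp add: ell2_def)

lemma contraction_kernel_row_summable:
  assumes K: "contraction_kernel I K" and i: "i \<in> I"
  shows "(\<lambda>j. (norm (K i j))\<^sup>2) summable_on I"
proof (rule nonneg_bdd_above_summable_on)
  show "bdd_above (sum (\<lambda>j. (norm (K i j))\<^sup>2) ` {F. F \<subseteq> I \<and> finite F})"
  proof (rule bdd_aboveI2)
    fix F assume F: "F \<in> {F. F \<subseteq> I \<and> finite F}"
    have psd: "psd_kernel I K" using K by (simp add: contraction_kernel_def)
    have "(\<Sum>j\<in>F. (norm (K i j))\<^sup>2) = (\<Sum>j\<in>F. (norm (K j i))\<^sup>2)"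
    proof (rule sum.cong[OF refl])
      fix j assume "j \<in> F"
      then have "j \<in> I" using F by auto
      then show "(norm (K i j))\<^sup>2 = (norm (K j i))\<^sup>2"
        using psd_kernel_herm[OF psd i, of j] by simp
    qed
    also have "\<dots> \<le> Re (K i i)" using contraction_kernel_col_le[OF K _ _ i, of F] F by simp
    finally show "(\<Sum>j\<in>F. (norm (K i j))\<^sup>2) \<le> Re (K i i)" .
  qed
qed simp

lemma norm_mult_le_sum_squares: "norm (a * b) \<le> (norm a)\<^sup>2 + (norm b)\<^sup>2" for a b :: complex
proof -
  have "0 \<le> norm a * norm b" by simp
  then show ?thesis using sum_squares_bound[of "norm a" "norm b"] unfolding norm_mult by linarith
qed

lemma kernel_row_summable:
  assumes K: "contraction_kernel I K" and i: "i \<in> I" and u: "u \<in> ell2 I"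
  shows "(\<lambda>j. K i j * u j) summable_on I"
proof (rule abs_summable_summable, rule summable_on_comparison_test)
  show "(\<lambda>j. (norm (K i j))\<^sup>2 + (norm (u j))\<^sup>2) summable_on I"
    by (intro summable_on_add contraction_kernel_row_summable[OF K i] ell2_summable[OF u])
  show "norm (K i j * u j) \<le> (norm (K i j))\<^sup>2 + (norm (u j))\<^sup>2" for j
    by (rule norm_mult_le_sum_squares)
qed simp

lemma kernel_operator_tendsto:
  assumes K: "contraction_kernel I K" and i: "i \<in> I" and u: "u \<in> ell2 I"
  shows "((\<lambda>G. \<Sum>j\<in>G. K i j * u j) \<longlongrightarrow> kernel_operator I K u i) (finite_subsets_at_top I)"
  using has_sum_infsum[OF kernel_row_summable[OF K i u]] i
  by (simp add: kernel_operator_def has_sum_def)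

text \<open>The finite contraction bound, for a rectangular section so that the limits over columns and over
  rows can be taken one after the other.\<close>

lemma contraction_kernel_rectangle:
  assumes K: "contraction_kernel I K" and F: "finite F" "F \<subseteq> I" and G: "finite G" "G \<subseteq> I"
  shows "(\<Sum>i\<in>F. (norm (\<Sum>j\<in>G. K i j * u j))\<^sup>2) \<le> (\<Sum>j\<in>G. (norm (u j))\<^sup>2)"
proof -
  let ?H = "F \<union> G"
  define v where "v j = (if j \<in> G then u j else 0)" for j
  have H: "finite ?H" "?H \<subseteq> I" using F G by auto
  have v: "(\<Sum>j\<in>?H. K i j * v j) = (\<Sum>j\<in>G. K i j * u j)" for i
    using H(1) by (intro sum.mono_neutral_cong_right) (auto simp: v_def)
  have "(\<Sum>i\<in>F. (norm (\<Sum>j\<in>G. K i j * u j))\<^sup>2) \<le> (\<Sum>i\<in>?H. (norm (\<Sum>j\<in>?H. K i j * v j))\<^sup>2)"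
    unfolding v using H(1) by (intro sum_mono2) auto
  also have "\<dots> \<le> Re (quad_form ?H K v)" by (rule contraction_kernel_norm[OF K H])
  also have "\<dots> \<le> (\<Sum>j\<in>?H. (norm (v j))\<^sup>2)"
    using psd_kernel_quad[of I "hole_kernel K" ?H v] K H quad_form_hole_kernel[OF H(1), of K v]
    by (simp add: contraction_kernel_def)
  also have "\<dots> = (\<Sum>j\<in>G. (norm (u j))\<^sup>2)"
    using H(1) by (intro sum.mono_neutral_cong_right) (auto simp: v_def)
  finally show ?thesis .
qed

lemma kernel_operator_finite_le:
  assumes K: "contraction_kernel I K" and u: "u \<in> ell2 I" and F: "finite F" "F \<subseteq> I"
  shows "(\<Sum>i\<in>F. (norm (kernel_operator I K u i))\<^sup>2) \<le> infsum (\<lambda>i. (norm (u i))\<^sup>2) I"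
proof (rule tendsto_upperbound)
  show "((\<lambda>G. \<Sum>i\<in>F. (norm (\<Sum>j\<in>G. K i j * u j))\<^sup>2) \<longlongrightarrow> (\<Sum>i\<in>F. (norm (kernel_operator I K u i))\<^sup>2)) (finite_subsets_at_top I)"
    using F by (intro tendsto_intros kernel_operator_tendsto[OF K _ u]) auto
  show "\<forall>\<^sub>F G in finite_subsets_at_top I. (\<Sum>i\<in>F. (norm (\<Sum>j\<in>G. K i j * u j))\<^sup>2) \<le> infsum (\<lambda>i. (norm (u i))\<^sup>2) I"
  proof (rule eventually_finite_subsets_at_top_weakI)
    fix G assume G: "finite G" "G \<subseteq> I"
    have "(\<Sum>i\<in>F. (norm (\<Sum>j\<in>G. K i j * u j))\<^sup>2) \<le> (\<Sum>j\<in>G. (norm (u j))\<^sup>2)"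
      by (rule contraction_kernel_rectangle[OF K F G])
    also have "\<dots> \<le> infsum (\<lambda>i. (norm (u i))\<^sup>2) I"
      by (rule finite_sum_le_infsum[OF ell2_summable[OF u] G]) simp
    finally show "(\<Sum>i\<in>F. (norm (\<Sum>j\<in>G. K i j * u j))\<^sup>2) \<le> infsum (\<lambda>i. (norm (u i))\<^sup>2) I" .
  qed
qed simp

lemma kernel_operator_ell2:
  assumes K: "contraction_kernel I K" and u: "u \<in> ell2 I"
  shows "kernel_operator I K u \<in> ell2 I"
proof -
  have "(\<lambda>i. (norm (kernel_operator I K u i))\<^sup>2) summable_on I"
    using kernel_operator_finite_le[OF K u]
    by (intro nonneg_bdd_above_summable_on bdd_aboveI2) auto
  then show ?thesis by (auto simp: ell2_def kernel_operator_def)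
qed

lemma kernel_operator_contractive:
  assumes K: "contraction_kernel I K" and u: "u \<in> ell2 I"
  shows "ell2_norm I (kernel_operator I K u) \<le> ell2_norm I u"
  unfolding ell2_norm_def
  using kernel_operator_finite_le[OF K u] ell2_summable[OF kernel_operator_ell2[OF K u]]
  by (intro real_sqrt_le_mono infsum_le_finite_sums) auto

lemma infsum_delta:
  fixes g :: "'a \<Rightarrow> complex"
  assumes "i \<in> I" "\<And>k. k \<in> I \<Longrightarrow> k \<noteq> i \<Longrightarrow> g k = 0"
  shows "infsum g I = g i"
proof -
  have "infsum g I = infsum g {i}" using assms by (intro infsum_cong_neutral) auto
  then show ?thesis by simp
qed

lemma kernel_operator_kernel:
  assumes "i \<in> I" "j \<in> I"
  shows "operator_kernel I (kernel_operator I K) i j = K i j"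
proof -
  have "operator_kernel I (kernel_operator I K) i j = kernel_operator I K (ell2_delta j) i"
    unfolding operator_kernel_def ell2_inner_def
    using infsum_delta[OF assms(1), of "\<lambda>k. kernel_operator I K (ell2_delta j) k * cnj (ell2_delta i k)"]
    by (simp add: ell2_delta_def)
  also have "\<dots> = K i j"
    using infsum_delta[OF assms(2), of "\<lambda>k. K i k * ell2_delta j k"] assms
    by (simp add: kernel_operator_def ell2_delta_def)
  finally show ?thesis .
qed

lemma kernel_operator_add:
  assumes K: "contraction_kernel I K" and u: "u \<in> ell2 I" and v: "v \<in> ell2 I"
  shows "kernel_operator I K (\<lambda>i. u i + v i) = (\<lambda>i. kernel_operator I K u i + kernel_operator I K v i)"
  using infsum_add[OF kernel_row_summable[OF K _ u] kernel_row_summable[OF K _ v]]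
  by (auto simp: kernel_operator_def fun_eq_iff distrib_left)

lemma kernel_operator_scale:
  "kernel_operator I K (\<lambda>i. c * u i) = (\<lambda>i. c * kernel_operator I K u i)"
  by (auto simp: kernel_operator_def fun_eq_iff mult.left_commute[of _ c] infsum_cmult_right')

text \<open>Truncating \<open>u\<close> to \<open>F\<close> changes \<open>A u\<close> by \<open>A w\<close> for the tail \<open>w\<close>. The Cauchy-Schwarz inequality and
  contractivity bound the error by the norm of the tail, which tends to zero.\<close>

lemma kernel_operator_quad_form_diff:
  assumes K: "contraction_kernel I K" and u: "u \<in> ell2 I" and F: "finite F" "F \<subseteq> I"
  shows "norm ((\<Sum>i\<in>F. kernel_operator I K u i * cnj (u i)) - quad_form F K u) \<le>
    sqrt (infsum (\<lambda>i. (norm (u i))\<^sup>2) I - (\<Sum>i\<in>F. (norm (u i))\<^sup>2)) * ell2_norm I u"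
proof -
  define w where "w i = (if i \<in> F then 0 else u i)" for i
  have w2: "((\<lambda>i. (norm (w i))\<^sup>2) summable_on I) \<and>
      infsum (\<lambda>i. (norm (w i))\<^sup>2) I = infsum (\<lambda>i. (norm (u i))\<^sup>2) I - (\<Sum>i\<in>F. (norm (u i))\<^sup>2)"
  proof -
    have "(\<lambda>i. (norm (u i))\<^sup>2) summable_on (I - F)"
      using ell2_summable[OF u] by (rule summable_on_subset_banach) auto
    moreover have "(\<lambda>i. (norm (u i))\<^sup>2) summable_on (I - F) \<longleftrightarrow> (\<lambda>i. (norm (w i))\<^sup>2) summable_on I"
      by (rule summable_on_cong_neutral) (auto simp: w_def)
    moreover have "infsum (\<lambda>i. (norm (w i))\<^sup>2) I = infsum (\<lambda>i. (norm (u i))\<^sup>2) (I - F)"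
      by (rule infsum_cong_neutral) (auto simp: w_def)
    moreover have "infsum (\<lambda>i. (norm (u i))\<^sup>2) (I - F) = infsum (\<lambda>i. (norm (u i))\<^sup>2) I - infsum (\<lambda>i. (norm (u i))\<^sup>2) F"
      using F by (intro infsum_Diff ell2_summable[OF u]) auto
    ultimately show ?thesis using F by simp
  qed
  then have w: "w \<in> ell2 I" using ell2_outside[OF u] by (auto simp: ell2_def w_def)
  have Aw: "kernel_operator I K w i = kernel_operator I K u i - (\<Sum>j\<in>F. K i j * u j)" if "i \<in> I" for i
  proof -
    have "infsum (\<lambda>j. K i j * w j) I = infsum (\<lambda>j. K i j * u j) (I - F)"
      by (rule infsum_cong_neutral) (auto simp: w_def)
    also have "\<dots> = infsum (\<lambda>j. K i j * u j) I - infsum (\<lambda>j. K i j * u j) F"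
      using F by (intro infsum_Diff kernel_row_summable[OF K that u]) auto
    finally show ?thesis using F that by (simp add: kernel_operator_def)
  qed
  have "(\<Sum>i\<in>F. kernel_operator I K u i * cnj (u i)) - quad_form F K u =
      (\<Sum>i\<in>F. kernel_operator I K w i * cnj (u i))"
    unfolding quad_form_def sum_subtractf[symmetric]
    using F by (intro sum.cong) (auto simp: Aw subset_iff left_diff_distrib sum_distrib_right)
  also have "norm \<dots> \<le> (\<Sum>i\<in>F. \<bar>norm (kernel_operator I K w i)\<bar> * \<bar>norm (u i)\<bar>)"
    by (rule order_trans[OF norm_sum]) (simp add: norm_mult)
  also have "\<dots> \<le> L2_set (\<lambda>i. norm (kernel_operator I K w i)) F * L2_set (\<lambda>i. norm (u i)) F"
    by (rule L2_set_mult_ineq)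
  also have "\<dots> \<le> sqrt (infsum (\<lambda>i. (norm (w i))\<^sup>2) I) * sqrt (infsum (\<lambda>i. (norm (u i))\<^sup>2) I)"
    unfolding L2_set_def
    using kernel_operator_finite_le[OF K w F] finite_sum_le_infsum[OF ell2_summable[OF u] F]
    by (intro mult_mono real_sqrt_le_mono) (auto intro!: sum_nonneg infsum_nonneg)
  finally show ?thesis using w2 by (simp add: ell2_norm_def)
qed

lemma ell2_inner_summable:
  assumes u: "u \<in> ell2 I" and v: "v \<in> ell2 I"
  shows "(\<lambda>i. u i * cnj (v i)) summable_on I"
proof (rule abs_summable_summable, rule summable_on_comparison_test)
  show "(\<lambda>j. (norm (u j))\<^sup>2 + (norm (v j))\<^sup>2) summable_on I"
    by (intro summable_on_add ell2_summable u v)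
  show "norm (u j * cnj (v j)) \<le> (norm (u j))\<^sup>2 + (norm (v j))\<^sup>2" for j
    using norm_mult_le_sum_squares[of "u j" "cnj (v j)"] by simp
qed simp

text \<open>Positivity passes from finite sections to the limit.\<close>

lemma kernel_operator_positive:
  assumes K: "contraction_kernel I K" and u: "u \<in> ell2 I"
  shows "ell2_inner I (kernel_operator I K u) u \<in> \<real> \<and> 0 \<le> Re (ell2_inner I (kernel_operator I K u) u)"
proof -
  let ?A = "kernel_operator I K u" and ?at = "finite_subsets_at_top I"
  let ?N = "infsum (\<lambda>i. (norm (u i))\<^sup>2) I"
  have psd: "psd_kernel I K" using K by (simp add: contraction_kernel_def)
  have lim1: "((\<lambda>F. \<Sum>i\<in>F. ?A i * cnj (u i)) \<longlongrightarrow> ell2_inner I ?A u) ?at"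
    using has_sum_infsum[OF ell2_inner_summable[OF kernel_operator_ell2[OF K u] u]]
    by (simp add: has_sum_def ell2_inner_def)
  have "((\<lambda>F. \<Sum>i\<in>F. (norm (u i))\<^sup>2) \<longlongrightarrow> ?N) ?at"
    using has_sum_infsum[OF ell2_summable[OF u]] by (simp add: has_sum_def)
  then have "((\<lambda>F. sqrt (?N - (\<Sum>i\<in>F. (norm (u i))\<^sup>2)) * ell2_norm I u) \<longlongrightarrow> sqrt (?N - ?N) * ell2_norm I u) ?at"
    by (intro tendsto_intros)
  then have lim0: "((\<lambda>F. sqrt (?N - (\<Sum>i\<in>F. (norm (u i))\<^sup>2)) * ell2_norm I u) \<longlongrightarrow> 0) ?at" by simp
  have "((\<lambda>F. (\<Sum>i\<in>F. ?A i * cnj (u i)) - quad_form F K u) \<longlongrightarrow> 0) ?at"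
    by (rule Lim_null_comparison[OF _ lim0], rule eventually_finite_subsets_at_top_weakI)
      (rule kernel_operator_quad_form_diff[OF K u])
  from tendsto_diff[OF lim1 this] have lim: "((\<lambda>F. quad_form F K u) \<longlongrightarrow> ell2_inner I ?A u) ?at" by simp
  have "Im (ell2_inner I ?A u) = 0"
  proof (rule tendsto_unique)
    show "((\<lambda>F. Im (quad_form F K u)) \<longlongrightarrow> Im (ell2_inner I ?A u)) ?at" by (rule tendsto_Im[OF lim])
    show "((\<lambda>F. Im (quad_form F K u)) \<longlongrightarrow> 0) ?at"
      using quad_form_real[OF psd] by (intro tendsto_eventually eventually_finite_subsets_at_top_weakI)
        (auto simp: complex_is_Real_iff)
  qed simp
  moreover have "0 \<le> Re (ell2_inner I ?A u)"
    using psd_kernel_quad[OF psd] by (intro tendsto_lowerbound[OF tendsto_Re[OF lim]]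
      eventually_finite_subsets_at_top_weakI) auto
  ultimately show ?thesis by (simp add: complex_is_Real_iff)
qed

theorem contraction_kernel_operator:
  assumes K: "contraction_kernel I K"
  shows "\<exists>A. bounded_operator I A \<and> (\<forall>i\<in>I. \<forall>j\<in>I. operator_kernel I A i j = K i j) \<and>
    positive_definite I A \<and> contractive I A"
proof (intro exI[of _ "kernel_operator I K"] conjI ballI)
  show "bounded_operator I (kernel_operator I K)"
    unfolding bounded_operator_def
    using kernel_operator_ell2[OF K] kernel_operator_add[OF K] kernel_operator_scale
      kernel_operator_contractive[OF K]
    by (intro conjI exI[of _ 1]) auto
  show "positive_definite I (kernel_operator I K)"
    unfolding positive_definite_def using kernel_operator_positive[OF K] by blast
  show "contractive I (kernel_operator I K)"
    unfolding contractive_def using kernel_operator_contractive[OF K] by blast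
qed (rule kernel_operator_kernel)

section \<open>The branching-Toeplitz determinantal process\<close>

theorem proposition1p20:
  fixes q :: nat and f :: "complex \<Rightarrow> real"
  assumes "q \<ge> 2"
    and "(\<lambda>\<theta>. f (cis \<theta>)) \<in> borel_measurable lebesgue"
    and "\<And>z. z \<in> sphere 0 1 \<Longrightarrow> f z \<in> {0..1}"
  shows "(\<exists>A. bounded_operator (tree_vertices q) A \<and>
            (\<forall>\<sigma>\<in>tree_vertices q. \<forall>\<tau>\<in>tree_vertices q.
               operator_kernel (tree_vertices q) A \<sigma> \<tau> = branching_toeplitz q f \<sigma> \<tau>) \<and>
            positive_definite (tree_vertices q) A \<and> contractive (tree_vertices q) A) \<and>
         (\<exists>!P. sets P = sets (PiM (tree_vertices q) (\<lambda>_. bit_space)) \<and>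
            determinantal_process P (tree_vertices q) (branching_toeplitz q f) (\<lambda>\<sigma> \<omega>. \<omega> \<sigma>)) \<and>
         (\<forall>(M :: 'w measure) X.
            determinantal_process M (tree_vertices q) (branching_toeplitz q f) X \<longrightarrow>
            branching_SSSP q M X \<and> automorphism_invariant q M X)"
proof -
  have q: "0 < q" using assms(1) by simp
  have "circle_weight f"
    unfolding circle_weight_def using assms(2) assms(3)[of "cis \<theta>" for \<theta>] by simp
  then have K: "contraction_kernel (tree_vertices q) (branching_toeplitz q f)"
    by (rule contraction_branching_toeplitz[OF q])
  show ?thesis
  proof (intro conjI allI impI)
    show "\<exists>A. bounded_operator (tree_vertices q) A \<and>
        (\<forall>\<sigma>\<in>tree_vertices q. \<forall>\<tau>\<in>tree_vertices q.
           operator_kernel (tree_vertices q) A \<sigma> \<tau> = branching_toeplitz q f \<sigma> \<tau>) \<and>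
        positive_definite (tree_vertices q) A \<and> contractive (tree_vertices q) A"
      by (rule contraction_kernel_operator[OF K])
    show "\<exists>!P. sets P = sets (PiM (tree_vertices q) (\<lambda>_. bit_space)) \<and>
        determinantal_process P (tree_vertices q) (branching_toeplitz q f) (\<lambda>\<sigma> \<omega>. \<omega> \<sigma>)"
      by (intro ex_ex1I determinantal_law_exists[OF K])
        (use determinantal_law_unique[of _ "tree_vertices q" "branching_toeplitz q f"] in blast)
    fix M :: "'w measure" and X
    assume D: "determinantal_process M (tree_vertices q) (branching_toeplitz q f) X"
    show "branching_SSSP q M X" by (rule determinantal_branching_SSSP[OF q D])
    show "automorphism_invariant q M X" by (rule determinantal_automorphism_invariant[OF D])
  qed
qed

end
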